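(* For every integer $r\ge 3$ there exist constants $c_1,c_2>0$ (depending only on $r$) such that for every integer $t>r$, \[ c_1\,\frac{\ln t}{t^{r-1}} \;\le\; \tau_{r-1}(t,r) \;\le\; c_2\,\frac{\ln t}{t^{r-1}}. \]
   Context: An $r$-graph $H$ is a vertex set $V(H)$ with a family $E(H)$ of $r$-element subsets (edges). For $S\subset V(H)$, $\deg(S)$ is the number of edges containing $S$; the maximum $\ell$-degree $\Delta_\ell(H)$ is the maximum of $\deg(S)$ over all $\ell$-subsets $S$ of $V(H)$. The independence number $\alpha(H)$ is the largest size of a vertex set containing no edge of $H$. Define $T_{\ell}(n,t,r)=\min\{\Delta_\ell(H): H \text{ an } r\text{-graph on } n \text{ vertices with } \alpha(H)<t\}$ and $\tau_\ell(t,r)=\lim_{n\to\infty} T_\ell(n,t,r)/\binom{n-\ell}{r-\ell}$ (this limit exists; equivalently $\tau_{r-1}(t,r)=1-\pi_{r-1}(K_t^r)$, where $\pi_{r-1}(K_t^r)=\lim_{n\to\infty}\mathrm{ex}_{r-1}(n,K_t^r)/n$ and $\mathrm{ex}_{r-1}(n,K_t^r)$ is the largest minimum $(r-1)$-degree of a $K_t^r$-free $r$-graph on $n$ vertices, $K_t^r$ being the complete $r$-graph on $t$ vertices). *)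

theory Defs
  imports Complex_Main "HOL-Library.Ramsey"
begin

text \<open>
  A finite r-graph is given by its vertex set and its edge set; \<open>[V]\<^bsup>r\<^esup>\<close> (from the Ramsey theory)
  is the set of r-element subsets of \<open>V\<close>.
\<close>

definition r_graph :: "nat \<Rightarrow> 'a set \<Rightarrow> 'a set set \<Rightarrow> bool"
  where "r_graph r V E \<longleftrightarrow> finite V \<and> E \<subseteq> [V]\<^bsup>r\<^esup>"

definition deg :: "'a set set \<Rightarrow> 'a set \<Rightarrow> nat"
  where "deg E S = card {e \<in> E. S \<subseteq> e}"

text \<open>Only meaningful for \<open>l \<le> card V\<close>: otherwise there are no \<open>l\<close>-subsets to maximise over.\<close>

definition max_degree :: "nat \<Rightarrow> 'a set \<Rightarrow> 'a set set \<Rightarrow> nat"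
  where "max_degree l V E = Max (deg E ` [V]\<^bsup>l\<^esup>)"

definition independent :: "'a set \<Rightarrow> 'a set set \<Rightarrow> 'a set \<Rightarrow> bool"
  where "independent V E I \<longleftrightarrow> I \<subseteq> V \<and> \<not> (\<exists>e\<in>E. e \<subseteq> I)"

definition independence_number :: "'a set \<Rightarrow> 'a set set \<Rightarrow> nat"
  where "independence_number V E = Max (card ` {I. independent V E I})"

text \<open>
  Every finite r-graph is isomorphic to one whose vertices are natural numbers, so it suffices to
  let \<open>V\<close> range over finite sets of natural numbers.  For \<open>r \<le> t\<close> the complete r-graph is admissible,
  so the minimum exists.
\<close>

definition T_min :: "nat \<Rightarrow> nat \<Rightarrow> nat \<Rightarrow> nat \<Rightarrow> nat"
  where "T_min l n t r = (LEAST d. \<exists>(V :: nat set) E.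
    r_graph r V E \<and> card V = n \<and> independence_number V E < t \<and> d = max_degree l V E)"

text \<open>The truncated subtraction \<open>n - l\<close> affects only the finitely many \<open>n < l\<close>, hence not the limit.\<close>

definition tau :: "nat \<Rightarrow> nat \<Rightarrow> nat \<Rightarrow> real"
  where "tau l t r = lim (\<lambda>n. real (T_min l n t r) / real ((n - l) choose (r - l)))"

end

theory Submission
  imports Defs "HOL-Library.FuncSet" "HOL-Real_Asymp.Real_Asymp"
begin

text \<open>
  Write \<open>l = r - 1\<close>.  The limit defining \<open>tau l t r\<close> exists because a random \<open>n\<close>-tuple of vertices of
  an \<open>r\<close>-graph on \<open>N \<ge> n\<close> vertices almost preserves the codegree density and creates no large
  independent set, so \<open>T_min l n t r / n\<close> is almost increasing.

  Upper bound: a random \<open>r\<close>-graph on \<open>t ^ r\<close> vertices with edge probability of order \<open>ln t / t ^ l\<close> has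
  no independent set of size about \<open>t / l\<close> and codegrees \<open>O (t ln t)\<close>.  Blow it up, adding all \<open>r\<close>-sets
  inside a group; an independent set then has at most \<open>l\<close> vertices in each group.

  Lower bound (in the spirit of Shearer and Alon): let the codegrees be \<open>\<le> \<delta> n\<close> with \<open>\<delta>\<close> a small multiple
  of \<open>ln t / t ^ l\<close>, suppose all independent sets are smaller than \<open>t\<close>, and sample \<open>M = t ^ (1 + \<theta>)\<close>
  random vertices one by one, keeping track of the number of independent sets of the sample.  An
  independent set \<open>W\<close> has at most \<open>t ^ l\<close> subsets of size \<open>l\<close>, so it contains on average at most
  \<open>\<delta> t ^ l\<close> link edges of a random vertex \<open>x\<close>.  The sample is so sparse that the link of \<open>x\<close> typically
  has no short cycles; then a proportion of at least \<open>2 powr (- O (\<delta> t ^ l))\<close>, a small negative power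
  of \<open>t\<close>, of all \<open>W\<close> contains no link edge and can be extended by \<open>x\<close>.  Hence the number of independent
  sets grows to \<open>exp (t powr (1 + \<theta> / 2))\<close> or so, more than the \<open>(M + 1) ^ t\<close> subsets of size below \<open>t\<close>.
\<close>

section \<open>Degrees and independent sets\<close>

lemma nsets_nonempty: "finite V \<Longrightarrow> l \<le> card V \<Longrightarrow> [V]\<^bsup>l\<^esup> \<noteq> {}"
  by (simp add: nsets_eq_empty_iff)

lemma max_degree_le_iff:
  assumes "finite V" "l \<le> card V"
  shows "max_degree l V E \<le> d \<longleftrightarrow> (\<forall>S\<in>[V]\<^bsup>l\<^esup>. deg E S \<le> d)"
  using nsets_nonempty[OF assms] finite_imp_finite_nsets[OF assms(1)]
  by (simp add: max_degree_def)

lemma independence_number_less_iff: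
  assumes "finite V" "{} \<notin> E"
  shows "independence_number V E < t \<longleftrightarrow> (\<forall>I. independent V E I \<longrightarrow> card I < t)"
proof -
  have "finite {I. independent V E I}"
    by (rule finite_subset[of _ "Pow V"]) (use assms in \<open>auto simp: independent_def\<close>)
  moreover have "{} \<in> {I. independent V E I}"
    using assms by (auto simp: independent_def)
  ultimately show ?thesis
    unfolding independence_number_def by (subst Max_less_iff) auto
qed

lemma r_graph_empty_notin: "r_graph r V E \<Longrightarrow> 0 < r \<Longrightarrow> {} \<notin> E"
  by (auto simp: r_graph_def nsets_def)

lemma T_min_le:
  fixes V :: "nat set"
  assumes "r_graph r V E" "0 < r" "card V = n" "l \<le> n"
    and "\<And>I. independent V E I \<Longrightarrow> card I < t"
    and "\<And>S. S \<in> [V]\<^bsup>l\<^esup> \<Longrightarrow> deg E S \<le> d"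
  shows "T_min l n t r \<le> d"
proof -
  have f: "finite V" using assms by (simp add: r_graph_def)
  have "independence_number V E < t"
    using assms f r_graph_empty_notin[OF assms(1,2)] by (subst independence_number_less_iff) auto
  then have "T_min l n t r \<le> max_degree l V E"
    unfolding T_min_def using assms by (intro Least_le) blast
  also have "\<dots> \<le> d" using assms f by (subst max_degree_le_iff) auto
  finally show ?thesis .
qed

text \<open>The complete \<open>r\<close>-graph makes the set of candidates nonempty, so the
  \<open>LEAST\<close> is attained. Arguments about \<open>T_min\<close> from below start from this
  extremal \<open>r\<close>-graph.\<close>

lemma T_min_witness:
  assumes "0 < r" "r \<le> t" "l \<le> n"
  obtains V :: "nat set" and E where "r_graph r V E" "card V = n"
    "\<And>I. independent V E I \<Longrightarrow> card I < t"
    "\<And>S. S \<in> [V]\<^bsup>l\<^esup> \<Longrightarrow> deg E S \<le> T_min l n t r"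
proof -
  let ?V = "{..<n}"
  let ?P = "\<lambda>d. \<exists>(V :: nat set) E. r_graph r V E \<and> card V = n \<and> independence_number V E < t \<and> d = max_degree l V E"
  have g: "r_graph r ?V ([?V]\<^bsup>r\<^esup>)" by (simp add: r_graph_def)
  have "card I < t" if "independent ?V ([?V]\<^bsup>r\<^esup>) I" for I
  proof (rule ccontr)
    assume "\<not> card I < t"
    then obtain e where "e \<subseteq> I" "card e = r" "finite e"
      using assms by (meson linorder_not_less obtain_subset_with_card_n le_trans)
    with that show False unfolding independent_def nsets_def by blast
  qed
  then have "independence_number ?V ([?V]\<^bsup>r\<^esup>) < t"
    using r_graph_empty_notin[OF g] assms by (subst independence_number_less_iff) auto
  with g have "\<exists>d. ?P d" by (metis card_lessThan)
  then have "?P (T_min l n t r)" unfolding T_min_def by (rule LeastI_ex)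
  then obtain V :: "nat set" and E where *: "r_graph r V E" "card V = n" "independence_number V E < t"
    "T_min l n t r = max_degree l V E" by blast
  have f: "finite V" using * by (simp add: r_graph_def)
  show ?thesis
  proof (rule that[of V E])
    show "deg E S \<le> T_min l n t r" if "S \<in> [V]\<^bsup>l\<^esup>" for S
      using max_degree_le_iff[OF f, of l E "T_min l n t r"] * assms that by auto
    show "card I < t" if "independent V E I" for I
      using * that assms f r_graph_empty_notin[OF *(1)] independence_number_less_iff by blast
  qed (use * in auto)
qed

lemma T_min_mono:
  assumes "0 < r" "r \<le> t" "t \<le> t'" "l \<le> n"
  shows "T_min l n t' r \<le> T_min l n t r"
proof -
  obtain V :: "nat set" and E where "r_graph r V E" "card V = n"
    "\<And>I. independent V E I \<Longrightarrow> card I < t"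
    "\<And>S. S \<in> [V]\<^bsup>l\<^esup> \<Longrightarrow> deg E S \<le> T_min l n t r"
    using T_min_witness assms by metis
  then show ?thesis using assms
    by (intro T_min_le[of r V E]) (auto intro: less_le_trans)
qed

lemma deg_eq_card_extensions:
  assumes "r_graph (Suc l) V E" "card S = l" "finite S"
  shows "deg E S = card {y. insert y S \<in> E}"
proof -
  have "bij_betw (\<lambda>y. insert y S) {y. insert y S \<in> E} {e \<in> E. S \<subseteq> e}"
  proof (rule bij_betwI')
    fix x y assume "x \<in> {y. insert y S \<in> E}" "y \<in> {y. insert y S \<in> E}"
    then have "card (insert x S) = Suc l" "card (insert y S) = Suc l"
      using assms by (auto simp: r_graph_def nsets_def)
    then have "x \<notin> S" "y \<notin> S" using assms by (auto simp: card_insert_if split: if_splits)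
    then show "(insert x S = insert y S) = (x = y)" by auto
  next
    fix e assume e: "e \<in> {e \<in> E. S \<subseteq> e}"
    then have c: "card e = Suc l" "finite e" using assms by (auto simp: r_graph_def nsets_def)
    then have "card (e - S) = 1" using assms e by (simp add: card_Diff_subset)
    then obtain y where "e - S = {y}" by (auto simp: card_1_singleton_iff)
    then have "e = insert y S" using e by auto
    then show "\<exists>x\<in>{y. insert y S \<in> E}. e = insert x S" using e by auto
  qed auto
  then show ?thesis unfolding deg_def by (simp add: bij_betw_same_card)
qed

text \<open>\<open>S\<close> may be smaller than \<open>l\<close> or leave \<open>V\<close>, because
  it will be the image of an index set under a tuple that need not be injective. In those cases no
  vertex extends it to an edge.\<close>

lemma card_extensions_le:
  assumes "r_graph (Suc l) V E" and "\<And>S. S \<in> [V]\<^bsup>l\<^esup> \<Longrightarrow> deg E S \<le> d" "finite S" "card S \<le> l"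
  shows "card {y. insert y S \<in> E} \<le> d"
proof (cases "S \<in> [V]\<^bsup>l\<^esup>")
  case True
  then show ?thesis using deg_eq_card_extensions[OF assms(1), of S] assms(2)[OF True]
    by (auto simp: nsets_def)
next
  case False
  have "insert y S \<notin> E" for y
  proof
    assume "insert y S \<in> E"
    then have *: "S \<subseteq> V" "card (insert y S) = Suc l"
      using assms by (auto simp: r_graph_def nsets_def)
    then have "card S = l" using assms card_insert_if[of S y] by (auto split: if_splits)
    then show False using * False assms by (auto simp: nsets_def)
  qed
  then show ?thesis by simp
qed

section \<open>Averaging over one coordinate of a random tuple\<close>

lemma sum_PiE_average_coordinate:
  fixes F :: "('i \<Rightarrow> 'a) \<Rightarrow> real"
  assumes "j \<in> I" "finite I" "finite V"
  shows "(\<Sum>s\<in>I \<rightarrow>\<^sub>E V. \<Sum>y\<in>V. F (s(j := y))) = card V * (\<Sum>s\<in>I \<rightarrow>\<^sub>E V. F s)"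
proof -
  let ?O = "I \<rightarrow>\<^sub>E V"
  have "(\<Sum>s\<in>?O. \<Sum>y\<in>V. F (s(j := y))) = (\<Sum>(s,y)\<in>?O \<times> V. F (s(j := y)))"
    by (simp add: sum.cartesian_product)
  \<comment> \<open>Exchanging \<open>s j\<close> with \<open>y\<close> is an involution on the
    pairs.\<close>
  also have "\<dots> = (\<Sum>(s,y)\<in>?O \<times> V. F s)"
    by (rule sum.reindex_bij_witness[of _ "\<lambda>(s,y). (s(j := y), s j)" "\<lambda>(s,y). (s(j := y), s j)"])
      (use assms in \<open>auto simp: PiE_iff extensional_def\<close>)
  also have "\<dots> = card V * (\<Sum>s\<in>?O. F s)"
    by (simp add: sum.cartesian_product[symmetric] sum_distrib_left)
  finally show ?thesis .
qed

text \<open>Fubini in the coordinate \<open>j\<close>: \<open>g\<close> ignores \<open>s j\<close>,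
  so only \<open>h\<close> is averaged while all other coordinates stay fixed. Most probability
  estimates below are instances, with \<open>g\<close> the indicator or weight of the events treated
  before.\<close>

lemma sum_PiE_coordinate_le:
  fixes g h :: "('i \<Rightarrow> 'a) \<Rightarrow> real" and c :: real
  assumes "j \<in> I" "finite I" "finite V" "V \<noteq> {}"
    and g: "\<And>s y. s \<in> I \<rightarrow>\<^sub>E V \<Longrightarrow> y \<in> V \<Longrightarrow> g (s(j := y)) = g s"
    and g0: "\<And>s. s \<in> I \<rightarrow>\<^sub>E V \<Longrightarrow> 0 \<le> g s"
    and h: "\<And>s. s \<in> I \<rightarrow>\<^sub>E V \<Longrightarrow> (\<Sum>y\<in>V. h (s(j := y))) \<le> c * card V"
  shows "(\<Sum>s\<in>I \<rightarrow>\<^sub>E V. g s * h s) \<le> c * (\<Sum>s\<in>I \<rightarrow>\<^sub>E V. g s)"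
proof -
  let ?O = "I \<rightarrow>\<^sub>E V"
  have pos: "real (card V) > 0" using assms by (simp add: card_gt_0_iff)
  have "card V * (\<Sum>s\<in>?O. g s * h s) = (\<Sum>s\<in>?O. \<Sum>y\<in>V. g (s(j := y)) * h (s(j := y)))"
    using sum_PiE_average_coordinate[OF assms(1-3), of "\<lambda>s. g s * h s"] by simp
  also have "\<dots> = (\<Sum>s\<in>?O. g s * (\<Sum>y\<in>V. h (s(j := y))))"
    by (simp add: g sum_distrib_left)
  also have "\<dots> \<le> (\<Sum>s\<in>?O. g s * (c * card V))"
    by (intro sum_mono mult_left_mono h g0)
  also have "\<dots> = card V * (c * (\<Sum>s\<in>?O. g s))"
    by (simp add: sum_distrib_left sum_distrib_right mult_ac)
  finally show ?thesis using pos by simp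
qed

lemma card_PiE_coincide:
  assumes "finite V" "V \<noteq> {}" "finite I" "i \<in> I" "j \<in> I" "i \<noteq> j"
  shows "card {s \<in> I \<rightarrow>\<^sub>E V. s i = s j} \<le> 1 / card V * card (I \<rightarrow>\<^sub>E V)"
proof -
  let ?O = "I \<rightarrow>\<^sub>E V"
  have fO: "finite ?O" using assms by (simp add: finite_PiE)
  have "real (card {s \<in> ?O. s i = s j}) = (\<Sum>s\<in>?O. 1 * (if s i = s j then 1 else 0 :: real))"
    using fO by (simp add: sum.If_cases Int_def)
  also have "\<dots> \<le> 1 / card V * (\<Sum>s\<in>?O. 1)"
    by (rule sum_PiE_coordinate_le[of j]) (use assms in \<open>auto simp: PiE_iff\<close>)
  finally show ?thesis by simp
qed

section \<open>Existence of the limit\<close>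

lemma exp_moment_PiE:
  fixes D :: "('i \<Rightarrow> 'a) \<Rightarrow> 'a set" and p \<theta> :: real
  assumes fin: "finite I" "finite V" "V \<noteq> {}" and "finite J" "J \<subseteq> I"
    and inv: "\<And>s j y. s \<in> I \<rightarrow>\<^sub>E V \<Longrightarrow> j \<in> J \<Longrightarrow> y \<in> V \<Longrightarrow> D (s(j := y)) = D s"
    and D: "\<And>s. s \<in> I \<rightarrow>\<^sub>E V \<Longrightarrow> card (V \<inter> D s) \<le> p * card V"
    and "0 \<le> p" "0 \<le> \<theta>"
  shows "(\<Sum>s\<in>I \<rightarrow>\<^sub>E V. \<Prod>j\<in>J. if s j \<in> D s then exp \<theta> else 1)
           \<le> (1 + p * (exp \<theta> - 1)) ^ card J * card (I \<rightarrow>\<^sub>E V)"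
  using assms(4,5) inv
proof (induction J rule: finite_induct)
  case empty
  then show ?case by simp
next
  case (insert j J)
  let ?O = "I \<rightarrow>\<^sub>E V" and ?w = "\<lambda>s j. if s j \<in> D s then exp \<theta> else 1 :: real"
  let ?c = "1 + p * (exp \<theta> - 1)"
  have c0: "0 \<le> ?c" using assms by simp
  \<comment> \<open>\<open>D s\<close> ignores the coordinates in \<open>J\<close>. So, given the
    others, these fall into \<open>D s\<close> independently with probability at most
    \<open>p\<close>, and each costs a factor \<open>?c\<close>.\<close>
  have "(\<Sum>s\<in>?O. (\<Prod>j\<in>J. ?w s j) * ?w s j) \<le> ?c * (\<Sum>s\<in>?O. \<Prod>j\<in>J. ?w s j)"
  proof (rule sum_PiE_coordinate_le[of j I V])
    fix s y assume s: "s \<in> ?O" and y: "y \<in> V"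
    show "(\<Prod>i\<in>J. ?w (s(j := y)) i) = (\<Prod>i\<in>J. ?w s i)"
    proof (intro prod.cong refl)
      fix i assume "i \<in> J"
      moreover have "D (s(j := y)) = D s" by (rule insert.prems(2)[OF s insertI1 y])
      ultimately show "?w (s(j := y)) i = ?w s i" using insert.hyps by auto
    qed
  next
    fix s assume s: "s \<in> ?O"
    have "(\<Sum>y\<in>V. ?w (s(j := y)) j) = (\<Sum>y\<in>V. 1 + (exp \<theta> - 1) * (if y \<in> D s then 1 else 0))"
    proof (intro sum.cong refl)
      fix y assume "y \<in> V"
      then have "D (s(j := y)) = D s" by (rule insert.prems(2)[OF s insertI1])
      then show "?w (s(j := y)) j = 1 + (exp \<theta> - 1) * (if y \<in> D s then 1 else 0)" by simp
    qed
    also have "\<dots> = card V + (exp \<theta> - 1) * card (V \<inter> D s)"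
      using fin by (simp add: sum.distrib sum_distrib_left[symmetric] sum.If_cases)
    also have "\<dots> \<le> card V + (exp \<theta> - 1) * (p * card V)"
      using D[OF s] assms by (intro add_left_mono mult_left_mono) auto
    also have "\<dots> = ?c * card V" by (simp add: algebra_simps)
    finally show "(\<Sum>y\<in>V. ?w (s(j := y)) j) \<le> ?c * card V" .
  qed (use fin insert.prems(1) in \<open>simp_all add: prod_nonneg\<close>)
  also have "\<dots> \<le> ?c * (?c ^ card J * card ?O)"
    using insert.IH insert.prems c0 by (intro mult_left_mono) auto
  finally show ?case using insert.hyps by (simp add: mult_ac)
qed

text \<open>Markov's inequality for the exponential moment. \<open>D s\<close> may depend on the
  coordinates outside \<open>J\<close>, since the neighbourhood of a sampled \<open>l\<close>-set is
  itself determined by the sample.\<close>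

lemma chernoff_PiE:
  fixes D :: "('i \<Rightarrow> 'a) \<Rightarrow> 'a set" and p \<epsilon> :: real and n :: nat
  assumes fin: "finite I" "finite V" "V \<noteq> {}" and J: "J \<subseteq> I" "card J \<le> n"
    and inv: "\<And>s j y. s \<in> I \<rightarrow>\<^sub>E V \<Longrightarrow> j \<in> J \<Longrightarrow> y \<in> V \<Longrightarrow> D (s(j := y)) = D s"
    and D: "\<And>s. s \<in> I \<rightarrow>\<^sub>E V \<Longrightarrow> card (V \<inter> D s) \<le> p * card V"
    and p: "0 \<le> p" "p \<le> 1" and \<epsilon>: "0 \<le> \<epsilon>" "\<epsilon> \<le> 1"
  shows "card {s \<in> I \<rightarrow>\<^sub>E V. (p + \<epsilon>) * n \<le> card {j \<in> J. s j \<in> D s}}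
           \<le> exp (- real n * \<epsilon>\<^sup>2 / 4) * card (I \<rightarrow>\<^sub>E V)"
proof -
  let ?O = "I \<rightarrow>\<^sub>E V"
  define \<theta> where "\<theta> = \<epsilon> / 2"
  let ?c = "1 + p * (exp \<theta> - 1)" and ?k = "\<lambda>s. card {j \<in> J. s j \<in> D s}"
  let ?B = "{s \<in> ?O. (p + \<epsilon>) * n \<le> ?k s}"
  have fJ: "finite J" using fin J by (meson finite_subset)
  have fO: "finite ?O" using fin by (simp add: finite_PiE)
  have l: "0 \<le> \<theta>" "\<theta> \<le> 1" using \<epsilon> by (auto simp: \<theta>_def)
  have prod_eq: "(\<Prod>j\<in>J. if s j \<in> D s then exp \<theta> else 1) = exp (\<theta> * ?k s)" for s
    using fJ by (simp add: prod.If_cases Int_def) (metis exp_of_nat_mult mult.commute)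
  have c1: "1 \<le> ?c" using p l by simp
  \<comment> \<open>On [0, 1] the exponential is at most 1 + \<theta> + \<theta>^2, which leads to
    the exponent \<theta>^2 - \<theta> \<epsilon> per sample point. Its minimum -\<epsilon>^2 / 4 is
    reached at \<open>\<theta> = \<epsilon> / 2\<close>.\<close>
  have "?c \<le> 1 + p * (\<theta> + \<theta>\<^sup>2)"
    using exp_bound[OF l] p by (intro add_left_mono mult_left_mono) auto
  also have "\<dots> \<le> exp (p * (\<theta> + \<theta>\<^sup>2))" by (rule exp_ge_add_one_self)
  also have "\<dots> \<le> exp (p * \<theta> + \<theta>\<^sup>2)"
    using p by (simp add: distrib_left mult_left_le_one_le)
  finally have c2: "?c \<le> exp (p * \<theta> + \<theta>\<^sup>2)" .
  have "exp (\<theta> * ((p + \<epsilon>) * n)) * card ?B = (\<Sum>s\<in>?B. exp (\<theta> * ((p + \<epsilon>) * n)))"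
    by simp
  also have "\<dots> \<le> (\<Sum>s\<in>?B. exp (\<theta> * ?k s))"
    using l by (intro sum_mono) (auto intro: mult_left_mono)
  also have "\<dots> \<le> (\<Sum>s\<in>?O. exp (\<theta> * ?k s))"
    using fO by (intro sum_mono2) auto
  also have "\<dots> \<le> ?c ^ card J * card ?O"
    using exp_moment_PiE[OF fin fJ J(1), where D = D and p = p and \<theta> = \<theta>] inv D p l
    by (simp add: prod_eq)
  also have "\<dots> \<le> ?c ^ n * card ?O"
    using c1 J by (intro mult_right_mono power_increasing) auto
  also have "\<dots> \<le> exp (p * \<theta> + \<theta>\<^sup>2) ^ n * card ?O"
    using c1 c2 by (intro mult_right_mono power_mono) auto
  also have "\<dots> = exp (\<theta> * ((p + \<epsilon>) * n)) * (exp (- real n * \<epsilon>\<^sup>2 / 4) * card ?O)"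
    by (simp add: exp_of_nat_mult[symmetric] exp_add[symmetric] mult.assoc[symmetric])
      (simp add: \<theta>_def power2_eq_square algebra_simps)
  finally show ?thesis by simp
qed

lemma card_not_inj_PiE:
  fixes V :: "'a set" and n :: nat
  assumes "finite V" "V \<noteq> {}"
  shows "card {s \<in> {..<n} \<rightarrow>\<^sub>E V. \<not> inj_on s {..<n}} \<le> real (n\<^sup>2) / card V * card ({..<n} \<rightarrow>\<^sub>E V)"
proof -
  let ?O = "{..<n} \<rightarrow>\<^sub>E V"
  let ?P = "{..<n} \<times> {..<n} - Id"
  have "{s \<in> ?O. \<not> inj_on s {..<n}} \<subseteq> (\<Union>(i,j)\<in>?P. {s \<in> ?O. s i = s j})"
    by (auto simp: inj_on_def)
  moreover have fO: "finite ?O" using assms by (simp add: finite_PiE)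
  ultimately have "card {s \<in> ?O. \<not> inj_on s {..<n}} \<le> card (\<Union>(i,j)\<in>?P. {s \<in> ?O. s i = s j})"
    by (intro card_mono) auto
  also have "\<dots> \<le> (\<Sum>(i,j)\<in>?P. card {s \<in> ?O. s i = s j})"
    by (rule order_trans[OF card_UN_le]) (auto simp: case_prod_unfold)
  finally have "card {s \<in> ?O. \<not> inj_on s {..<n}} \<le> (\<Sum>(i,j)\<in>?P. real (card {s \<in> ?O. s i = s j}))"
    by (simp add: case_prod_unfold flip: of_nat_sum)
  also have "\<dots> \<le> (\<Sum>(i,j)\<in>?P. 1 / card V * card ?O)"
  proof (rule sum_mono)
    fix x assume "x \<in> ?P"
    then obtain i j where x: "x = (i, j)" and ij: "i < n" "j < n" "(i, j) \<notin> Id" by auto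
    then have "real (card {s \<in> ?O. s i = s j}) \<le> 1 / card V * card ?O"
      using assms by (intro card_PiE_coincide) auto
    then show "(case x of (i, j) \<Rightarrow> real (card {s \<in> ?O. s i = s j})) \<le> (case x of (i, j) \<Rightarrow> 1 / card V * card ?O)"
      using x by simp
  qed
  also have "\<dots> = card ?P * (1 / card V * card ?O)" by (simp add: case_prod_unfold)
  also have "\<dots> \<le> real (n\<^sup>2) * (1 / card V * card ?O)"
  proof (intro mult_right_mono)
    have "card ?P \<le> card ({..<n} \<times> {..<n})" by (intro card_mono) auto
    then show "real (card ?P) \<le> real (n\<^sup>2)" by (simp add: power2_eq_square flip: of_nat_mult)
  qed simp
  finally show ?thesis by simp
qed

lemma T_min_le_self:
  assumes "Suc l \<le> t" "l \<le> n"
  shows "T_min l n t (Suc l) \<le> n"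
proof -
  obtain V :: "nat set" and E where *: "r_graph (Suc l) V E" "card V = n"
    "\<And>I. independent V E I \<Longrightarrow> card I < t"
    using T_min_witness[OF zero_less_Suc assms] by metis
  show ?thesis
  proof (rule T_min_le[OF *(1)])
    fix S assume S: "S \<in> [V]\<^bsup>l\<^esup>"
    have "{y. insert y S \<in> E} \<subseteq> V" using * by (auto simp: r_graph_def nsets_def)
    then have "card {y. insert y S \<in> E} \<le> n"
      using * by (metis card_mono r_graph_def)
    then show "deg E S \<le> n" using deg_eq_card_extensions[OF *(1), of S] S by (auto simp: nsets_def)
  qed (use * assms in auto)
qed

text \<open>Pull \<open>E\<close> back along a random map \<open>s\<close> from
  \<open>{..<n}\<close> to \<open>V\<close>. If \<open>s\<close> is injective, independent sets keep
  their size; the Chernoff bound and a union over all \<open>l\<close>-sets control the codegrees.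
  By \<open>small\<close> the failure probabilities add up to less than 1.\<close>

lemma T_min_sample:
  fixes V :: "nat set"
  assumes H: "r_graph (Suc l) V E" "card V = N"
    and ind: "\<And>I. independent V E I \<Longrightarrow> card I < t"
    and deg: "\<And>S. S \<in> [V]\<^bsup>l\<^esup> \<Longrightarrow> deg E S \<le> d"
    and d: "d \<le> N" and n: "l \<le> n" "0 < N" and \<epsilon>: "0 \<le> \<epsilon>" "\<epsilon> \<le> 1"
    and small: "real n ^ l * exp (- real n * \<epsilon>\<^sup>2 / 4) + real (n\<^sup>2) / N < 1"
  shows "T_min l n t (Suc l) \<le> (d / N + \<epsilon>) * n"
proof -
  let ?O = "{..<n} \<rightarrow>\<^sub>E V"
  define p where "p = real d / N"
  have fV: "finite V" "V \<noteq> {}" using H n by (auto simp: r_graph_def)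
  have fO: "finite ?O" using fV by (simp add: finite_PiE)
  have cO: "0 < card ?O" using fO fV by (auto simp: card_gt_0_iff PiE_eq_empty_iff)
  \<comment> \<open>\<open>D S s\<close> reads \<open>s\<close> only on \<open>S\<close>, hence is
    constant while the coordinates outside \<open>S\<close> vary, as \<open>chernoff_PiE\<close>
    requires.\<close>
  define D where "D S s = {y. insert y (s ` S) \<in> E}" for S :: "nat set" and s :: "nat \<Rightarrow> nat"
  define B where "B S = {s \<in> ?O. (p + \<epsilon>) * n \<le> card {j \<in> {..<n} - S. s j \<in> D S s}}" for S
  let ?B0 = "{s \<in> ?O. \<not> inj_on s {..<n}}"
  have B: "card (B S) \<le> exp (- real n * \<epsilon>\<^sup>2 / 4) * card ?O" if S: "S \<in> [{..<n}]\<^bsup>l\<^esup>" for S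
    unfolding B_def
  proof (rule chernoff_PiE)
    fix s assume "s \<in> ?O"
    have "card (s ` S) \<le> l" using S card_image_le[of S s] by (auto simp: nsets_def)
    moreover have "finite (s ` S)" using S by (auto simp: nsets_def)
    ultimately have "card (D S s) \<le> d" unfolding D_def by (intro card_extensions_le[OF H(1) deg]) auto
    moreover have "V \<inter> D S s = D S s" unfolding D_def using H by (auto simp: r_graph_def nsets_def)
    ultimately show "card (V \<inter> D S s) \<le> p * card V" unfolding p_def using H n by simp
  next
    fix s :: "nat \<Rightarrow> nat" and j y assume "j \<in> {..<n} - S"
    then have "(s(j := y)) ` S = s ` S" by auto
    then show "D S (s(j := y)) = D S s" unfolding D_def by simp
  next
    show "card ({..<n} - S) \<le> n" using card_mono[of "{..<n}" "{..<n} - S"] by simp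
  qed (use fV \<epsilon> d n in \<open>auto simp: p_def\<close>)
  have "real (card (?B0 \<union> (\<Union>S\<in>[{..<n}]\<^bsup>l\<^esup>. B S))) \<le> card ?B0 + (\<Sum>S\<in>[{..<n}]\<^bsup>l\<^esup>. card (B S))"
    unfolding of_nat_add[symmetric] of_nat_le_iff
    by (intro order_trans[OF card_Un_le] add_left_mono card_UN_le finite_imp_finite_nsets) simp
  also have "\<dots> \<le> real (n\<^sup>2) / N * card ?O + (\<Sum>S\<in>[{..<n}]\<^bsup>l\<^esup>. exp (- real n * \<epsilon>\<^sup>2 / 4) * card ?O)"
    unfolding of_nat_sum of_nat_add using card_not_inj_PiE[OF fV, of n] H(2) by (intro add_mono sum_mono B) simp
  also have "\<dots> \<le> real (n\<^sup>2) / N * card ?O + real n ^ l * (exp (- real n * \<epsilon>\<^sup>2 / 4) * card ?O)"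
  proof -
    have "card ([{..<n}]\<^bsup>l\<^esup>) \<le> n ^ l"
      using binomial_le_pow[OF n(1)] by (simp add: card_nsets)
    then have "real (card ([{..<n}]\<^bsup>l\<^esup>)) \<le> real n ^ l" by (metis of_nat_le_iff of_nat_power)
    then show ?thesis by (simp add: mult_right_mono)
  qed
  also have "\<dots> = (real n ^ l * exp (- real n * \<epsilon>\<^sup>2 / 4) + real (n\<^sup>2) / N) * card ?O"
    by (simp add: algebra_simps)
  also have "\<dots> < card ?O" using mult_strict_right_mono[OF small, of "card ?O"] cO by simp
  finally have "card (?B0 \<union> (\<Union>S\<in>[{..<n}]\<^bsup>l\<^esup>. B S)) < card ?O" by simp
  moreover have fB: "finite (?B0 \<union> (\<Union>S\<in>[{..<n}]\<^bsup>l\<^esup>. B S))"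
    by (rule finite_subset[OF _ fO]) (auto simp: B_def)
  ultimately obtain s where s: "s \<in> ?O" "s \<notin> ?B0 \<union> (\<Union>S\<in>[{..<n}]\<^bsup>l\<^esup>. B S)"
    by (metis (no_types, lifting) card_mono finite_subset linorder_not_less subsetI fO fB)
  then have inj: "inj_on s {..<n}" and nB: "\<And>S. S \<in> [{..<n}]\<^bsup>l\<^esup> \<Longrightarrow> s \<notin> B S" by auto
  define E' where "E' = {F \<in> [{..<n}]\<^bsup>Suc l\<^esup>. s ` F \<in> E}"
  have H': "r_graph (Suc l) {..<n} E'" by (auto simp: r_graph_def E'_def)
  have "T_min l n t (Suc l) \<le> nat \<lfloor>(p + \<epsilon>) * n\<rfloor>"
  proof (rule T_min_le[OF H'])
    fix I assume I: "independent {..<n} E' I"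
    have "independent V E (s ` I)"
      unfolding independent_def
    proof (intro conjI notI)
      show "s ` I \<subseteq> V" using I s by (auto simp: independent_def)
      assume "\<exists>e\<in>E. e \<subseteq> s ` I"
      then obtain F where F: "s ` F \<in> E" "F \<subseteq> I" by (metis subset_imageE)
      have "card (s ` F) = card F" "finite F"
        using F I inj by (auto simp: independent_def intro!: card_image intro: inj_on_subset finite_subset)
      then have "F \<in> E'" using F I H(1) by (auto simp: E'_def nsets_def independent_def r_graph_def)
      then show False using F I by (auto simp: independent_def)
    qed
    then have "card (s ` I) < t" by (rule ind)
    then show "card I < t" using I inj by (metis card_image independent_def inj_on_subset)
  next
    fix S assume S: "S \<in> [{..<n}]\<^bsup>l\<^esup>"
    have "{y. insert y S \<in> E'} \<subseteq> {j \<in> {..<n} - S. s j \<in> D S s}"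
    proof
      fix y assume y: "y \<in> {y. insert y S \<in> E'}"
      then have "y \<notin> S" using S by (auto simp: E'_def nsets_def insert_absorb)
      then show "y \<in> {j \<in> {..<n} - S. s j \<in> D S s}" using y by (auto simp: E'_def D_def nsets_def)
    qed
    then have "deg E' S \<le> card {j \<in> {..<n} - S. s j \<in> D S s}"
      using deg_eq_card_extensions[OF H', of S] S by (auto simp: nsets_def intro!: card_mono)
    also have "real \<dots> \<le> (p + \<epsilon>) * n" using nB[OF S] s by (auto simp: B_def)
    finally show "deg E' S \<le> nat \<lfloor>(p + \<epsilon>) * n\<rfloor>" by linarith
  qed (use n in auto)
  moreover have "0 \<le> (p + \<epsilon>) * n" using \<epsilon> by (simp add: p_def)
  ultimately show ?thesis unfolding p_def[symmetric] by linarith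
qed

text \<open>A monotone subsequence provides the limit \<open>L\<close>. Late terms are at most
  \<open>L + e / 3\<close> by comparison with far terms of the subsequence, and above
  \<open>L - 2 * e / 3\<close> by comparison with a single good one.\<close>

lemma convergent_if_eventually_almost_increasing:
  fixes b :: "nat \<Rightarrow> real"
  assumes bnd: "\<And>n. 0 \<le> b n \<and> b n \<le> 1"
    and inc: "\<And>\<epsilon>. 0 < \<epsilon> \<Longrightarrow> \<forall>\<^sub>F n in sequentially. \<forall>\<^sub>F N in sequentially. b n \<le> b N + \<epsilon>"
  shows "convergent b"
proof -
  obtain k :: "nat \<Rightarrow> nat" where k1: "strict_mono k" "monoseq (\<lambda>n. b (k n))"
    using seq_monosub by blast
  have "Bseq (\<lambda>n. b (k n))" using bnd by (intro BseqI'[of _ 1]) (auto simp: abs_le_iff)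
  then obtain L where "(b \<circ> k) \<longlonglongrightarrow> L"
    using Bseq_monoseq_convergent k1 by (auto simp: convergent_def o_def)
  note k = k1(1) this
  have "b \<longlonglongrightarrow> L"
  proof (rule LIMSEQ_I)
    fix e :: real assume e: "0 < e"
    have inc': "\<forall>\<^sub>F n in sequentially. \<forall>\<^sub>F N in sequentially. b n \<le> b N + e / 3"
      using inc[of "e / 3"] e by simp
    have up: "\<forall>\<^sub>F n in sequentially. b n \<le> L + e / 3"
      using inc'
    proof eventually_elim
      case (elim n)
      then have "\<forall>\<^sub>F i in sequentially. b n \<le> (b \<circ> k) i + e / 3"
        using filterlim_subseq[OF k(1)] unfolding filterlim_iff by auto
      moreover have "(\<lambda>i. (b \<circ> k) i + e / 3) \<longlonglongrightarrow> L + e / 3" by (intro tendsto_intros k)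
      ultimately show "b n \<le> L + e / 3"
        using tendsto_lowerbound by (metis trivial_limit_sequentially)
    qed
    have "\<forall>\<^sub>F i in sequentially. \<forall>\<^sub>F N in sequentially. b (k i) \<le> b N + e / 3"
      using inc' filterlim_subseq[OF k(1)] unfolding filterlim_iff by auto
    moreover have "\<forall>\<^sub>F i in sequentially. L - e / 3 < (b \<circ> k) i"
      using e by (intro order_tendstoD(1)[OF k(2)]) auto
    ultimately have "\<forall>\<^sub>F i in sequentially. L - e / 3 < b (k i) \<and> (\<forall>\<^sub>F N in sequentially. b (k i) \<le> b N + e / 3)"
      by eventually_elim auto
    then obtain i where i: "L - e / 3 < b (k i)" "\<forall>\<^sub>F N in sequentially. b (k i) \<le> b N + e / 3"
      by (metis (mono_tags, lifting) eventually_sequentially order_refl)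
    have "\<forall>\<^sub>F n in sequentially. norm (b n - L) < e"
      using up i(2) by eventually_elim (use i(1) e in auto)
    then show "\<exists>no. \<forall>n\<ge>no. norm (b n - L) < e" by (simp add: eventually_sequentially)
  qed
  then show ?thesis by (auto simp: convergent_def)
qed

lemma T_min_ratio_convergent:
  assumes "Suc l \<le> t"
  shows "convergent (\<lambda>n. real (T_min l n t (Suc l)) / n)"
proof -
  let ?b = "\<lambda>n. real (T_min l n t (Suc l)) / n"
  \<comment> \<open>The shift avoids the \<open>n < l\<close>, where no \<open>l\<close>-subsets
    exist and \<open>T_min_le_self\<close> gives no bound.\<close>
  have "convergent (\<lambda>n. ?b (n + l))"
  proof (rule convergent_if_eventually_almost_increasing)
    show "0 \<le> ?b (n + l) \<and> ?b (n + l) \<le> 1" for n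
      using T_min_le_self[OF assms, of "n + l"] by (auto simp: divide_le_eq)
  next
    fix \<epsilon> :: real assume "0 < \<epsilon>"
    define \<delta> where "\<delta> = min \<epsilon> 1"
    have \<delta>: "0 < \<delta>" "\<delta> \<le> 1" "\<delta> \<le> \<epsilon>" using \<open>0 < \<epsilon>\<close> by (auto simp: \<delta>_def)
    have "(\<lambda>n. real n ^ l * exp (- real n * \<delta>\<^sup>2 / 4)) \<longlonglongrightarrow> 0"
      using \<delta>(1) by real_asymp
    then have "\<forall>\<^sub>F n in sequentially. real n ^ l * exp (- real n * \<delta>\<^sup>2 / 4) < 1"
      by (rule order_tendstoD) simp
    moreover have "\<forall>\<^sub>F n in sequentially. 0 < n \<and> l \<le> n"
      using eventually_gt_at_top[of 0] eventually_ge_at_top[of l] by eventually_elim auto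
    ultimately have "\<forall>\<^sub>F n in sequentially. \<forall>\<^sub>F N in sequentially. ?b n \<le> ?b N + \<epsilon>"
    proof eventually_elim
      case (elim n)
      define q where "q = real n ^ l * exp (- real n * \<delta>\<^sup>2 / 4)"
      have "q < 1" using elim by (simp add: q_def)
      have "(\<lambda>N. q + real (n\<^sup>2) / real N) \<longlonglongrightarrow> q"
        by real_asymp
      then have "\<forall>\<^sub>F N in sequentially. q + real (n\<^sup>2) / real N < 1"
        by (rule order_tendstoD) fact
      moreover have "\<forall>\<^sub>F N in sequentially. 0 < N \<and> l \<le> N"
        using eventually_gt_at_top[of 0] eventually_ge_at_top[of l] by eventually_elim auto
      ultimately show ?case
      proof eventually_elim
        case (elim N)
        let ?d = "T_min l N t (Suc l)"
        have "?d \<le> N" using elim assms by (intro T_min_le_self) auto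
        moreover obtain V :: "nat set" and E where "r_graph (Suc l) V E" "card V = N"
          "\<And>I. independent V E I \<Longrightarrow> card I < t" "\<And>S. S \<in> [V]\<^bsup>l\<^esup> \<Longrightarrow> deg E S \<le> ?d"
          using T_min_witness[OF zero_less_Suc assms, of l N] elim by metis
        ultimately have "T_min l n t (Suc l) \<le> (?d / N + \<delta>) * n"
          using elim \<delta> \<open>0 < n \<and> l \<le> n\<close> unfolding q_def by (intro T_min_sample) auto
        then have "?b n \<le> ?d / N + \<delta>" using \<open>0 < n \<and> l \<le> n\<close> by (simp add: divide_le_eq)
        then show ?case using \<delta> by simp
      qed
    qed
    then have "\<forall>\<^sub>F n in sequentially. \<forall>\<^sub>F N in sequentially. ?b n \<le> ?b (N + l) + \<epsilon>"
      by (rule eventually_mono) (subst eventually_sequentially_seg)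
    then show "\<forall>\<^sub>F n in sequentially. \<forall>\<^sub>F N in sequentially. ?b (n + l) \<le> ?b (N + l) + \<epsilon>"
      by (subst eventually_sequentially_seg)
  qed
  then show ?thesis using convergent_ignore_initial_segment[of ?b l] by blast
qed

lemma T_min_ratio_tendsto_tau:
  assumes "Suc l \<le> t"
  shows "(\<lambda>n. real (T_min l n t (Suc l)) / n) \<longlonglongrightarrow> tau l t (Suc l)"
proof -
  obtain L where L: "(\<lambda>n. real (T_min l n t (Suc l)) / n) \<longlonglongrightarrow> L"
    using T_min_ratio_convergent[OF assms] by (auto simp: convergent_def)
  \<comment> \<open>The denominator in \<open>tau\<close> is \<open>(n - l) choose 1\<close>, not
    \<open>n\<close>; the quotient of the two tends to 1.\<close>
  have "(\<lambda>n. real n / real (n - l)) \<longlonglongrightarrow> 1" by real_asymp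
  from tendsto_mult[OF L this] have "(\<lambda>n. real (T_min l n t (Suc l)) / n * (real n / real (n - l))) \<longlonglongrightarrow> L"
    by simp
  moreover have "\<forall>\<^sub>F n in sequentially. real (T_min l n t (Suc l)) / n * (real n / real (n - l))
      = real (T_min l n t (Suc l)) / real ((n - l) choose (Suc l - l))"
    using eventually_gt_at_top[of 0] by eventually_elim simp
  ultimately have "(\<lambda>n. real (T_min l n t (Suc l)) / real ((n - l) choose (Suc l - l))) \<longlonglongrightarrow> L"
    by (rule Lim_transform_eventually)
  then have "tau l t (Suc l) = L" unfolding tau_def by (rule limI)
  with L show ?thesis by simp
qed

section \<open>Extending independent sets by a vertex\<close>

text \<open>Pair \<open>S\<close> with its complement \<open>A - S\<close>: together they contain
  each element of \<open>X\<close> exactly once.\<close>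

lemma sum_card_Int_Pow:
  assumes "finite A" "X \<subseteq> A"
  shows "2 * (\<Sum>S\<in>Pow A. real (card (S \<inter> X))) = card X * 2 ^ card A"
proof -
  have fX: "finite X" using assms by (meson finite_subset)
  have "(\<Sum>S\<in>Pow A. real (card (S \<inter> X))) = (\<Sum>S\<in>Pow A. real (card ((A - S) \<inter> X)))"
    by (rule sum.reindex_bij_witness[of _ "\<lambda>S. A - S" "\<lambda>S. A - S"]) (auto simp: double_diff)
  moreover have "card (S \<inter> X) + card ((A - S) \<inter> X) = card X" if "S \<subseteq> A" for S
    using fX assms that by (subst card_Un_disjoint[symmetric]) (auto intro!: arg_cong[of _ _ card])
  then have "(\<Sum>S\<in>Pow A. real (card (S \<inter> X)) + real (card ((A - S) \<inter> X))) = (\<Sum>S\<in>Pow A. real (card X))"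
    by (intro sum.cong) (auto simp flip: of_nat_add)
  ultimately have "2 * (\<Sum>S\<in>Pow A. real (card (S \<inter> X))) = (\<Sum>S\<in>Pow A. real (card X))"
    by (simp add: sum.distrib)
  then show ?thesis using assms by (simp add: card_Pow)
qed

text \<open>Jensen's inequality for the convex function 2^(-x), by means of the tangent at
  \<open>y\<close>. The tangent is decreasing, so an upper bound \<open>y\<close> on the weighted
  mean suffices.\<close>

lemma powr_minus_sum_ge:
  fixes w x :: "'b \<Rightarrow> real"
  assumes "\<And>i. i \<in> A \<Longrightarrow> 0 \<le> w i" and avg: "(\<Sum>i\<in>A. w i * x i) \<le> y * (\<Sum>i\<in>A. w i)"
  shows "2 powr (- y) * (\<Sum>i\<in>A. w i) \<le> (\<Sum>i\<in>A. w i * 2 powr (- x i))"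
proof -
  have tangent: "2 powr (- y) * (1 + (y - x i) * ln 2) \<le> 2 powr (- x i)" for i
  proof -
    have "1 + (y - x i) * ln 2 \<le> exp ((y - x i) * ln 2)" by (rule exp_ge_add_one_self)
    then have "2 powr (- y) * (1 + (y - x i) * ln 2) \<le> 2 powr (- y) * 2 powr (y - x i)"
      by (intro mult_left_mono) (auto simp: powr_def)
    then show ?thesis by (simp flip: powr_add)
  qed
  have "2 powr (- y) * (\<Sum>i\<in>A. w i)
      \<le> 2 powr (- y) * ((\<Sum>i\<in>A. w i) + (y * (\<Sum>i\<in>A. w i) - (\<Sum>i\<in>A. w i * x i)) * ln 2)"
    using avg by (intro mult_left_mono) auto
  also have "\<dots> = (\<Sum>i\<in>A. w i * (2 powr (- y) * (1 + (y - x i) * ln 2)))"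
    by (simp add: algebra_simps sum.distrib sum_subtractf sum_distrib_left sum_distrib_right)
  also have "\<dots> \<le> (\<Sum>i\<in>A. w i * 2 powr (- x i))"
    by (intro sum_mono mult_left_mono tangent assms)
  finally show ?thesis .
qed

lemma finite_independent: "finite R \<Longrightarrow> finite {W. independent R E W}"
  by (rule finite_subset[of _ "Pow R"]) (auto simp: independent_def)

text \<open>
  Pick one vertex \<open>b f\<close> from every link edge \<open>f\<close> of \<open>x\<close>, and let \<open>B\<close> be the set of these vertices.
  Since no edge meets two link edges, once \<open>W - B\<close> is fixed, \<open>W \<inter> B\<close> ranges over all subsets of a
  set \<open>B'\<close>, and \<open>W\<close> contains exactly \<open>card (W \<inter> X)\<close> link edges for some \<open>X \<subseteq> B'\<close>.  So among these
  \<open>W\<close> the average number of link edges is \<open>card X / 2\<close>, and a \<open>2 powr (- card X)\<close> proportion has none.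
\<close>

lemma card_independent_insert:
  fixes R :: "'a set" and E :: "'a set set" and x :: 'a and \<kappa> :: real
  defines "L \<equiv> {f. f \<subseteq> R \<and> insert x f \<in> E}"
  assumes R: "finite R" "x \<notin> R" and ne: "{} \<notin> L"
    and dis: "\<And>f g. f \<in> L \<Longrightarrow> g \<in> L \<Longrightarrow> f \<noteq> g \<Longrightarrow> f \<inter> g = {}"
    and cross: "\<And>e f g. e \<in> E \<Longrightarrow> e \<subseteq> R \<Longrightarrow> f \<in> L \<Longrightarrow> g \<in> L \<Longrightarrow> f \<noteq> g \<Longrightarrow> e \<inter> f = {} \<or> e \<inter> g = {}"
    and avg: "(\<Sum>W | independent R E W. card {f \<in> L. f \<subseteq> W}) \<le> \<kappa> * card {W. independent R E W}"
  shows "(1 + 2 powr (- 2 * \<kappa>)) * card {W. independent R E W} \<le> card {W. independent (insert x R) E W}"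
proof -
  have fL: "finite L" using R by (auto simp: L_def intro: finite_subset[of _ "Pow R"])
  obtain b where b: "\<And>f. f \<in> L \<Longrightarrow> b f \<in> f" using ne by (metis all_not_in_conv)
  define B where "B = b ` L"
  have bL: "b g \<in> f \<Longrightarrow> f = g" if "f \<in> L" "g \<in> L" for f g
    using that dis b by blast
  have BR: "B \<subseteq> R" using b by (auto simp: B_def L_def)
  define B' where "B' W0 = {u \<in> B. independent R E (insert u W0)}" for W0
  define X where "X W0 = {u \<in> B' W0. \<exists>f\<in>L. b f = u \<and> f - {u} \<subseteq> W0}" for W0
  let ?I = "{W. independent R E W}" and ?K = "{W. independent (R - B) E W}"
  let ?S = "SIGMA W0:?K. Pow (B' W0)"
  have fI0: "finite ?K" using R by (simp add: finite_independent)
  have fB': "finite (B' W0)" and XB': "X W0 \<subseteq> B' W0" and B'B: "B' W0 \<subseteq> B" for W0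
    using fL by (auto simp: B'_def X_def B_def)
  have fX: "finite (X W0)" for W0 using fB' XB' by (meson finite_subset)
  have bij: "bij_betw (\<lambda>(W0, S). W0 \<union> S) ?S ?I"
  proof (rule bij_betw_byWitness[where f' = "\<lambda>W. (W - B, W \<inter> B)"])
    show "\<forall>a\<in>?S. (\<lambda>W. (W - B, W \<inter> B)) ((\<lambda>(W0, S). W0 \<union> S) a) = a"
      using B'B by (auto simp: independent_def)
    show "\<forall>W\<in>?I. (\<lambda>(W0, S). W0 \<union> S) (W - B, W \<inter> B) = W" by auto
    show "(\<lambda>(W0, S). W0 \<union> S) ` ?S \<subseteq> ?I"
    proof (rule image_subsetI)
      fix a assume "a \<in> ?S"
      then obtain W0 S where a: "a = (W0, S)" and W0: "independent (R - B) E W0" and S: "S \<subseteq> B' W0"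
        by auto
      have sub: "W0 \<union> S \<subseteq> R" using W0 S B'B BR by (auto simp: independent_def)
      have "independent R E (W0 \<union> S)"
        unfolding independent_def
      proof (intro conjI notI sub)
        assume "\<exists>e\<in>E. e \<subseteq> W0 \<union> S"
        then obtain e where e: "e \<in> E" "e \<subseteq> W0 \<union> S" by auto
        show False
        proof (cases "e \<subseteq> W0")
          case True
          then show False using e W0 by (auto simp: independent_def)
        next
          case False
          then obtain f where f: "f \<in> L" "b f \<in> e" "b f \<in> S" using e S B'B by (force simp: B_def)
          \<comment> \<open>A second vertex \<open>b g\<close> on \<open>e\<close> would make
            \<open>e\<close> meet two link edges, against \<open>cross\<close>. So \<open>e\<close>
            contains only one vertex of \<open>S\<close>, and such edges are excluded by the
            definition of \<open>B'\<close>.\<close>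
          have "e \<subseteq> insert (b f) W0"
          proof
            fix u assume u: "u \<in> e"
            show "u \<in> insert (b f) W0"
            proof (rule ccontr)
              assume "u \<notin> insert (b f) W0"
              then obtain g where g: "g \<in> L" "u = b g" "g \<noteq> f" using u e S B'B by (force simp: B_def)
              then show False using cross[OF e(1) _ f(1) g(1)] e(2) sub f g u b by blast
            qed
          qed
          moreover have "independent R E (insert (b f) W0)" using f S by (auto simp: B'_def)
          ultimately show False using e by (auto simp: independent_def)
        qed
      qed
      then show "(case a of (W0, S) \<Rightarrow> W0 \<union> S) \<in> ?I" using a by simp
    qed
    show "(\<lambda>W. (W - B, W \<inter> B)) ` ?I \<subseteq> ?S"
    proof (rule image_subsetI)
      fix W assume "W \<in> ?I"
      then have W: "independent R E W" by simp
      have "independent (R - B) E (W - B)" using W by (auto simp: independent_def)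
      moreover have "independent R E (insert u (W - B))" if "u \<in> W \<inter> B" for u
        using W that by (auto simp: independent_def)
      ultimately show "(W - B, W \<inter> B) \<in> ?S" by (auto simp: B'_def)
    qed
  qed
  \<comment> \<open>\<open>W0\<close> avoids \<open>B\<close>, so a link edge inside the union has
    its representative \<open>b f\<close> in \<open>S\<close>. Its other vertices are outside
    \<open>B\<close> by disjointness, hence in \<open>W0\<close>.\<close>
  have count: "card {f \<in> L. f \<subseteq> W0 \<union> S} = card (S \<inter> X W0)"
    if W0: "independent (R - B) E W0" and S: "S \<subseteq> B' W0" for W0 S
  proof -
    have "b ` {f \<in> L. f \<subseteq> W0 \<union> S} = S \<inter> X W0"
    proof (intro equalityI subsetI)
      fix u assume "u \<in> b ` {f \<in> L. f \<subseteq> W0 \<union> S}"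
      then obtain f where f: "f \<in> L" "f \<subseteq> W0 \<union> S" "u = b f" by auto
      have "u \<in> S" using f b W0 by (auto simp: B_def independent_def)
      moreover have "f - {u} \<subseteq> W0" using f S B'B bL by (force simp: B_def)
      ultimately show "u \<in> S \<inter> X W0" using f S by (auto simp: X_def)
    next
      fix u assume u: "u \<in> S \<inter> X W0"
      then obtain f where "f \<in> L" "b f = u" "f - {u} \<subseteq> W0" by (auto simp: X_def)
      then show "u \<in> b ` {f \<in> L. f \<subseteq> W0 \<union> S}" using u by auto
    qed
    moreover have "inj_on b L" using bL b by (metis inj_onI)
    ultimately show ?thesis by (metis (no_types, lifting) card_image inj_on_subset mem_Collect_eq subsetI)
  qed
  have sumI: "(\<Sum>W\<in>?I. \<phi> W) = (\<Sum>W0\<in>?K. \<Sum>S\<in>Pow (B' W0). \<phi> (W0 \<union> S))" for \<phi> :: "'a set \<Rightarrow> real"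
    using sum.reindex_bij_betw[OF bij, of \<phi>] fI0 fB'
    by (simp add: sum.Sigma case_prod_unfold)
  define w where "w W0 = (2::real) ^ card (B' W0)" for W0
  have cI: "real (card ?I) = (\<Sum>W0\<in>?K. w W0)"
    using sumI[of "\<lambda>_. 1"] fB' by (simp add: w_def card_Pow)
  \<comment> \<open>On the fibre over \<open>W0\<close>, a subset contains half of
    \<open>X W0\<close> on average. So \<open>avg\<close> bounds the mean of
    \<open>card (X W0)\<close>, weighted by the fibre sizes \<open>w W0\<close>, by
    \<open>2 * \<kappa>\<close>.\<close>
  have "2 * (\<Sum>W\<in>?I. real (card {f \<in> L. f \<subseteq> W})) = (\<Sum>W0\<in>?K. 2 * (\<Sum>S\<in>Pow (B' W0). real (card (S \<inter> X W0))))"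
    unfolding sumI sum_distrib_left using count by (intro sum.cong refl) auto
  also have "\<dots> = (\<Sum>W0\<in>?K. w W0 * card (X W0))"
    using sum_card_Int_Pow[OF fB' XB'] by (simp add: w_def mult.commute)
  finally have "(\<Sum>W0\<in>?K. w W0 * card (X W0)) \<le> 2 * \<kappa> * (\<Sum>W0\<in>?K. w W0)"
    using avg cI by simp
  then have "2 powr (- (2 * \<kappa>)) * card ?I \<le> (\<Sum>W0\<in>?K. w W0 * 2 powr (- real (card (X W0))))"
    unfolding cI by (intro powr_minus_sum_ge) (auto simp: w_def)
  also have "\<dots> = (\<Sum>W0\<in>?K. \<Sum>S\<in>Pow (B' W0). if \<forall>f\<in>L. \<not> f \<subseteq> W0 \<union> S then 1 else 0 :: real)"
  proof (intro sum.cong refl)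
    fix W0 assume W0: "W0 \<in> ?K"
    have "{S \<in> Pow (B' W0). \<forall>f\<in>L. \<not> f \<subseteq> W0 \<union> S} = Pow (B' W0 - X W0)"
    proof -
      have "(\<forall>f\<in>L. \<not> f \<subseteq> W0 \<union> S) \<longleftrightarrow> S \<inter> X W0 = {}" if "S \<subseteq> B' W0" for S
      proof -
        have "(\<forall>f\<in>L. \<not> f \<subseteq> W0 \<union> S) \<longleftrightarrow> card {f \<in> L. f \<subseteq> W0 \<union> S} = 0"
          using fL by auto
        also have "\<dots> \<longleftrightarrow> S \<inter> X W0 = {}" using count[OF _ that] W0 fX by auto
        finally show ?thesis .
      qed
      then show ?thesis by auto
    qed
    then have "(\<Sum>S\<in>Pow (B' W0). if \<forall>f\<in>L. \<not> f \<subseteq> W0 \<union> S then 1 else 0 :: real) = 2 ^ card (B' W0 - X W0)"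
      using fB'[of W0] by (simp add: sum.If_cases Int_def card_Pow)
    also have "\<dots> = w W0 * 2 powr (- real (card (X W0)))"
      using card_mono[OF fB' XB', of W0] card_Diff_subset[OF fX XB', of W0]
      by (simp add: w_def powr_minus powr_realpow power_diff divide_inverse)
    finally show "w W0 * 2 powr (- real (card (X W0))) = (\<Sum>S\<in>Pow (B' W0). if \<forall>f\<in>L. \<not> f \<subseteq> W0 \<union> S then 1 else 0)"
      by simp
  qed
  also have "\<dots> = card {W \<in> ?I. \<forall>f\<in>L. \<not> f \<subseteq> W}"
    using finite_independent[OF R(1), of E]
    by (subst sumI[symmetric]) (simp add: sum.If_cases Int_def conj_commute)
  finally have gain: "2 powr (- 2 * \<kappa>) * card ?I \<le> card {W \<in> ?I. \<forall>f\<in>L. \<not> f \<subseteq> W}" (is "_ \<le> real (card ?J)") by simp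
  have fI: "finite ?I" using finite_independent[OF R(1)] .
  \<comment> \<open>The old independent sets and those of \<open>?J\<close> enlarged by
    \<open>x\<close> are disjoint families; together they give the factor 1 + 2^(-2
    \<kappa>).\<close>
  have "insert x ` ?J \<subseteq> {W. independent (insert x R) E W}"
  proof (rule image_subsetI)
    fix W assume "W \<in> ?J"
    then have W: "independent R E W" "\<forall>f\<in>L. \<not> f \<subseteq> W" by auto
    have "independent (insert x R) E (insert x W)"
      unfolding independent_def
    proof (intro conjI notI)
      show "insert x W \<subseteq> insert x R" using W by (auto simp: independent_def)
      assume "\<exists>e\<in>E. e \<subseteq> insert x W"
      then obtain e where e: "e \<in> E" "e \<subseteq> insert x W" by auto
      then have "x \<in> e" using W by (auto simp: independent_def)
      then have "insert x (e - {x}) \<in> E" using e by (simp add: insert_absorb)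
      moreover have "e - {x} \<subseteq> W" using e by auto
      ultimately show False using W unfolding L_def independent_def by blast
    qed
    then show "insert x W \<in> {W. independent (insert x R) E W}" by simp
  qed
  moreover have "?I \<subseteq> {W. independent (insert x R) E W}" by (auto simp: independent_def)
  ultimately have "card (?I \<union> insert x ` ?J) \<le> card {W. independent (insert x R) E W}"
    using R by (intro card_mono finite_independent) auto
  moreover have "card (?I \<union> insert x ` ?J) = card ?I + card ?J"
  proof -
    have "inj_on (insert x) ?J"
      using R by (intro inj_onI) (auto simp: independent_def insert_ident dest: subsetD)
    moreover have "?I \<inter> insert x ` ?J = {}" using R by (auto simp: independent_def)
    moreover have "finite ?J" using fI by simp
    ultimately show ?thesis using fI by (simp add: card_Un_disjoint card_image)
  qed
  ultimately show ?thesis using gain by (simp add: algebra_simps)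
qed

section \<open>Short cycles in random tuples\<close>

text \<open>Resample only the coordinate \<open>v\<close>: the other vertices of the edge have at
  most \<open>d\<close> completions, and \<open>P\<close> ignores \<open>v\<close>. Repeated use
  bounds the probability that several edges appear together.\<close>

lemma card_PiE_edge_le:
  assumes H: "r_graph (Suc l) V E" "V \<noteq> {}" and deg: "\<And>S. S \<in> [V]\<^bsup>l\<^esup> \<Longrightarrow> deg E S \<le> d"
    and "finite I" "A \<subseteq> I" "card A = Suc l" "v \<in> A"
    and P: "\<And>s y. P (s(v := y)) = P s"
  shows "card {s \<in> I \<rightarrow>\<^sub>E V. P s \<and> s ` A \<in> E} \<le> d / card V * card {s \<in> I \<rightarrow>\<^sub>E V. P s}"
proof -
  let ?O = "I \<rightarrow>\<^sub>E V"
  have fV: "finite V" using H by (simp add: r_graph_def)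
  have fO: "finite ?O" using fV assms by (simp add: finite_PiE)
  have fA: "finite A" using assms by (meson finite_subset)
  have "real (card {s \<in> ?O. P s \<and> s ` A \<in> E}) = (\<Sum>s\<in>?O. if P s \<and> s ` A \<in> E then 1 else 0)"
    using fO by (simp add: sum.If_cases Int_def)
  also have "\<dots> = (\<Sum>s\<in>?O. (if P s then 1 else 0) * (if s ` A \<in> E then 1 else 0))"
    by (intro sum.cong) auto
  also have "\<dots> \<le> d / card V * (\<Sum>s\<in>?O. if P s then 1 else 0)"
  proof (rule sum_PiE_coordinate_le[of v])
    fix s assume "s \<in> ?O"
    have img: "(s(v := y)) ` A = insert y (s ` (A - {v}))" for y using \<open>v \<in> A\<close> by auto
    have "(\<Sum>y\<in>V. if (s(v := y)) ` A \<in> E then 1 else 0 :: real) = card {y \<in> V. insert y (s ` (A - {v})) \<in> E}"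
      unfolding img using fV by (simp add: sum.If_cases Int_def)
    also have "{y \<in> V. insert y (s ` (A - {v})) \<in> E} = {y. insert y (s ` (A - {v})) \<in> E}"
      using H by (auto simp: r_graph_def nsets_def)
    also have "card \<dots> \<le> d"
      using fA card_image_le[of "A - {v}" s] assms by (intro card_extensions_le[OF H(1) deg]) auto
    finally show "(\<Sum>y\<in>V. if (s(v := y)) ` A \<in> E then 1 else 0) \<le> d / card V * card V"
      using H fV by simp
  qed (use assms fV in auto)
  also have "(\<Sum>s\<in>?O. if P s then 1 else 0 :: real) = card {s \<in> ?O. P s}"
    using fO by (simp add: sum.If_cases Int_def)
  finally show ?thesis .
qed

section \<open>Counting the index patterns of short cycles\<close>

lemma card_nsets_le_power:
  assumes "finite A" "card A \<le> n"
  shows "finite ([A]\<^bsup>k\<^esup>)" "card ([A]\<^bsup>k\<^esup>) \<le> n ^ k"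
proof -
  show "finite ([A]\<^bsup>k\<^esup>)" using assms finite_imp_finite_nsets by blast
  have "card ([A]\<^bsup>k\<^esup>) \<le> card A ^ k"
    using binomial_le_pow[of k "card A"] assms
    by (cases "k \<le> card A") (simp_all add: card_nsets binomial_eq_0)
  also have "\<dots> \<le> n ^ k" using assms by (intro power_mono) auto
  finally show "card ([A]\<^bsup>k\<^esup>) \<le> n ^ k" .
qed

lemma card_nsets_containing:
  assumes "finite A" "card A \<le> n" "T \<subseteq> A"
  shows "card {F \<in> [A]\<^bsup>(card T + k)\<^esup>. T \<subseteq> F} \<le> n ^ k"
proof -
  have fT: "finite T" using assms by (meson finite_subset)
  have "{F \<in> [A]\<^bsup>(card T + k)\<^esup>. T \<subseteq> F} \<subseteq> (\<union>) T ` [A]\<^bsup>k\<^esup>"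
  proof
    fix F assume F: "F \<in> {F \<in> [A]\<^bsup>(card T + k)\<^esup>. T \<subseteq> F}"
    then have "F - T \<in> [A]\<^bsup>k\<^esup>" using fT by (auto simp: nsets_def card_Diff_subset)
    moreover have "F = T \<union> (F - T)" using F by auto
    ultimately show "F \<in> (\<union>) T ` [A]\<^bsup>k\<^esup>" by (metis imageI)
  qed
  then show ?thesis
    using card_nsets_le_power[OF assms(1,2), of k]
    by (meson card_image_le card_mono finite_imageI order_trans)
qed

text \<open>Index patterns for a failure of \<open>dis\<close> in
  \<open>card_independent_insert\<close>: when \<open>j\<close> is the position of the new vertex
  and \<open>insert j F\<close>, \<open>insert j G\<close> are mapped to edges, two link edges may
  overlap.\<close>

definition link_pairs :: "nat \<Rightarrow> nat set \<Rightarrow> (nat set \<times> nat set) set"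
  where "link_pairs l J = {(F, G). F \<in> [J]\<^bsup>l\<^esup> \<and> G \<in> [J]\<^bsup>l\<^esup> \<and> F \<noteq> G \<and> F \<inter> G \<noteq> {}}"

text \<open>Index patterns for a failure of \<open>cross\<close>: an edge on \<open>A\<close> meets
  two link edges of the new vertex. Taking \<open>F\<close> and \<open>G\<close> disjoint forces
  \<open>A\<close> to meet them in two different indices; overlapping ones belong to
  \<open>link_pairs\<close>.\<close>

definition link_triples :: "nat \<Rightarrow> nat set \<Rightarrow> (nat set \<times> nat set \<times> nat set) set"
  where "link_triples l J = {(F, G, A). F \<in> [J]\<^bsup>l\<^esup> \<and> G \<in> [J]\<^bsup>l\<^esup> \<and> A \<in> [J]\<^bsup>Suc l\<^esup> \<and>
    F \<inter> G = {} \<and> A \<inter> F \<noteq> {} \<and> A \<inter> G \<noteq> {}}"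

text \<open>Choose \<open>F\<close>, an index of \<open>F\<close> shared with \<open>G\<close>, and
  the other \<open>l - 1\<close> indices of \<open>G\<close>. The overlap saves one power of
  \<open>m\<close>.\<close>

lemma card_link_pairs:
  assumes "finite J" "card J \<le> m" "1 \<le> l"
  shows "finite (link_pairs l J)" "card (link_pairs l J) \<le> l * m ^ (2 * l - 1)"
proof -
  note N = card_nsets_le_power[OF assms(1,2)]
  let ?U = "\<lambda>F. \<Union>u\<in>F. {G \<in> [J]\<^bsup>(card {u} + (l - 1))\<^esup>. {u} \<subseteq> G}"
  have fin: "finite (?U F)" if "F \<in> [J]\<^bsup>l\<^esup>" for F
  proof -
    have "finite F" using that by (auto simp: nsets_def)
    then show ?thesis using N(1) by simp
  qed
  have U: "card (?U F) \<le> l * m ^ (l - 1)" if F: "F \<in> [J]\<^bsup>l\<^esup>" for F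
  proof -
    have "card (?U F) \<le> (\<Sum>u\<in>F. card {G \<in> [J]\<^bsup>(card {u} + (l - 1))\<^esup>. {u} \<subseteq> G})"
      using F by (intro card_UN_le) (auto simp: nsets_def)
    also have "\<dots> \<le> (\<Sum>u\<in>F. m ^ (l - 1))"
      using F by (intro sum_mono card_nsets_containing assms) (auto simp: nsets_def)
    finally show ?thesis using F by (simp add: nsets_def)
  qed
  have sub: "link_pairs l J \<subseteq> (SIGMA F:[J]\<^bsup>l\<^esup>. ?U F)"
    using assms by (auto simp: link_pairs_def)
  have finS: "finite (SIGMA F:[J]\<^bsup>l\<^esup>. ?U F)" using N fin by (intro finite_SigmaI)
  from finite_subset[OF sub finS] show "finite (link_pairs l J)" .
  have "card (link_pairs l J) \<le> (\<Sum>F\<in>[J]\<^bsup>l\<^esup>. card (?U F))"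
    using card_mono[OF finS sub] N fin by (subst (asm) card_SigmaI) auto
  also have "\<dots> \<le> (\<Sum>F\<in>[J]\<^bsup>l\<^esup>. l * m ^ (l - 1))" by (intro sum_mono U)
  also have "\<dots> \<le> m ^ l * (l * m ^ (l - 1))" using N(2)[of l] by simp
  also have "\<dots> = l * m ^ (2 * l - 1)"
    using assms by (simp add: power_add[symmetric] mult.left_commute mult_2)
  finally show "card (link_pairs l J) \<le> l * m ^ (2 * l - 1)" .
qed

text \<open>Choose \<open>F\<close> and \<open>G\<close>, one index of \<open>A\<close> in each of
  them, and the other \<open>l - 1\<close> indices of \<open>A\<close>.\<close>

lemma card_link_triples:
  assumes "finite J" "card J \<le> m" "1 \<le> l"
  shows "finite (link_triples l J)" "card (link_triples l J) \<le> l\<^sup>2 * m ^ (3 * l - 1)"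
proof -
  note N = card_nsets_le_power[OF assms(1,2)]
  let ?N = "[J]\<^bsup>l\<^esup>"
  \<comment> \<open>Without \<open>Id\<close> the two indices differ, so the sets \<open>A\<close>
    have size \<open>Suc l\<close>. For disjoint \<open>F\<close> and \<open>G\<close> no pair is
    lost.\<close>
  let ?U = "\<lambda>F G. \<Union>(u, v)\<in>F \<times> G - Id. {A \<in> [J]\<^bsup>(card {u, v} + (l - 1))\<^esup>. {u, v} \<subseteq> A}"
  have fin: "finite (?U F G)" if "F \<in> ?N" "G \<in> ?N" for F G
  proof -
    have "finite (F \<times> G - Id)" using that by (auto simp: nsets_def)
    then show ?thesis using N(1) by (simp add: case_prod_unfold)
  qed
  have U: "card (?U F G) \<le> l\<^sup>2 * m ^ (l - 1)" if F: "F \<in> ?N" "G \<in> ?N" for F G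
  proof -
    have fFG: "finite (F \<times> G - Id)" using F by (auto simp: nsets_def)
    have "card (?U F G) \<le> (\<Sum>(u, v)\<in>F \<times> G - Id. card {A \<in> [J]\<^bsup>(card {u, v} + (l - 1))\<^esup>. {u, v} \<subseteq> A})"
      by (rule order_trans[OF card_UN_le[OF fFG]]) (simp add: case_prod_unfold)
    also have "\<dots> \<le> (\<Sum>(u, v)\<in>F \<times> G - Id. m ^ (l - 1))"
      unfolding case_prod_unfold
      using F by (intro sum_mono card_nsets_containing assms) (auto simp: nsets_def)
    also have "\<dots> = card (F \<times> G - Id) * m ^ (l - 1)" by (simp add: case_prod_unfold)
    also have "\<dots> \<le> card (F \<times> G) * m ^ (l - 1)"
      using F by (intro mult_right_mono card_mono) (auto simp: nsets_def)
    finally show ?thesis using F by (simp add: nsets_def power2_eq_square card_cartesian_product)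
  qed
  have sub: "link_triples l J \<subseteq> (SIGMA F:?N. SIGMA G:?N. ?U F G)"
  proof
    fix x assume "x \<in> link_triples l J"
    then obtain F G A where x: "x = (F, G, A)" "F \<in> ?N" "G \<in> ?N" "A \<in> [J]\<^bsup>Suc l\<^esup>"
      "F \<inter> G = {}" "A \<inter> F \<noteq> {}" "A \<inter> G \<noteq> {}" by (auto simp: link_triples_def)
    then obtain u v where uv: "u \<in> A" "u \<in> F" "v \<in> A" "v \<in> G" "u \<noteq> v" by blast
    then have "card {u, v} + (l - 1) = Suc l" using assms by simp
    then have "A \<in> ?U F G" using uv x by force
    then show "x \<in> (SIGMA F:?N. SIGMA G:?N. ?U F G)" using x by simp
  qed
  have finS: "finite (SIGMA F:?N. SIGMA G:?N. ?U F G)" using N fin by (intro finite_SigmaI)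
  from finite_subset[OF sub finS] show "finite (link_triples l J)" .
  have "card (link_triples l J) \<le> (\<Sum>F\<in>?N. \<Sum>G\<in>?N. card (?U F G))"
    using card_mono[OF finS sub] N fin by (simp add: card_SigmaI finite_SigmaI)
  also have "\<dots> \<le> (\<Sum>F\<in>?N. \<Sum>G\<in>?N. l\<^sup>2 * m ^ (l - 1))" by (intro sum_mono U)
  also have "\<dots> = card ?N * (card ?N * (l\<^sup>2 * m ^ (l - 1)))" by simp
  also have "\<dots> \<le> m ^ l * (m ^ l * (l\<^sup>2 * m ^ (l - 1)))"
    by (intro mult_le_mono N order_refl)
  also have "\<dots> = l\<^sup>2 * m ^ (l + l + (l - 1))"
    by (simp only: power_add mult_ac)
  also have "l + l + (l - 1) = 3 * l - 1" using assms by simp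
  finally show "card (link_triples l J) \<le> l\<^sup>2 * m ^ (3 * l - 1)" .
qed

text \<open>\<open>G\<close> has an index \<open>v\<close> outside \<open>F\<close>, as both have
  size \<open>l\<close>. Resampling \<open>v\<close> pays for the edge through \<open>G\<close>
  while the other edge is kept; resampling \<open>j\<close> then pays for the edge through
  \<open>F\<close>.\<close>

lemma card_PiE_link_pair:
  assumes H: "r_graph (Suc l) V E" "V \<noteq> {}" and deg: "\<And>S. S \<in> [V]\<^bsup>l\<^esup> \<Longrightarrow> deg E S \<le> d"
    and I: "finite I" "J \<subseteq> I" "j \<in> I" "j \<notin> J" and p: "(F, G) \<in> link_pairs l J"
  shows "card {s \<in> I \<rightarrow>\<^sub>E V. s ` insert j F \<in> E \<and> s ` insert j G \<in> E}
    \<le> (d / card V)\<^sup>2 * card (I \<rightarrow>\<^sub>E V)"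
proof -
  let ?O = "I \<rightarrow>\<^sub>E V" and ?\<delta> = "real d / card V"
  have FG: "F \<subseteq> J" "G \<subseteq> J" "finite F" "finite G" "card F = l" "card G = l" "F \<noteq> G"
    using p by (auto simp: link_pairs_def nsets_def)
  then obtain v where v: "v \<in> G" "v \<notin> F" by (metis card_subset_eq subsetI)
  have j: "j \<notin> F" "j \<notin> G" "v \<noteq> j" using FG I v by auto
  have img: "(s(v := y)) ` insert j F = s ` insert j F" for s :: "nat \<Rightarrow> 'a" and y
    using v j by auto
  have "card {s \<in> ?O. s ` insert j F \<in> E \<and> s ` insert j G \<in> E} \<le> ?\<delta> * card {s \<in> ?O. s ` insert j F \<in> E}"
    by (rule card_PiE_edge_le[OF H deg I(1), of _ v]) (use FG I v j img in auto)
  also have "\<dots> \<le> ?\<delta> * (?\<delta> * card {s \<in> ?O. True})"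
    using card_PiE_edge_le[OF H deg I(1), of "insert j F" j "\<lambda>_. True"] FG I j
    by (intro mult_left_mono) auto
  finally show ?thesis by (simp add: power2_eq_square)
qed

text \<open>
  The three edges can be ordered so that each has a vertex outside the previous ones; as \<open>2 \<le> l\<close>, the
  edge \<open>A\<close> cannot contain both \<open>F\<close> and \<open>G\<close>.  Each such vertex costs a factor \<open>d / card V\<close>.
\<close>

lemma card_PiE_link_triple:
  assumes H: "r_graph (Suc l) V E" "V \<noteq> {}" and deg: "\<And>S. S \<in> [V]\<^bsup>l\<^esup> \<Longrightarrow> deg E S \<le> d" and l: "2 \<le> l"
    and I: "finite I" "J \<subseteq> I" "j \<in> I" "j \<notin> J" and p: "(F, G, A) \<in> link_triples l J"
  shows "card {s \<in> I \<rightarrow>\<^sub>E V. s ` insert j F \<in> E \<and> s ` insert j G \<in> E \<and> s ` A \<in> E}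
    \<le> (d / card V) ^ 3 * card (I \<rightarrow>\<^sub>E V)"
proof -
  let ?O = "I \<rightarrow>\<^sub>E V" and ?\<delta> = "real d / card V"
  \<comment> \<open>Stated for fresh \<open>F\<close> and \<open>G\<close>, so that it also applies
    with their roles exchanged when \<open>G\<close> is the one not contained in
    \<open>A\<close>.\<close>
  have peel: "card {s \<in> ?O. s ` insert j F \<in> E \<and> s ` insert j G \<in> E \<and> s ` A \<in> E} \<le> ?\<delta> ^ 3 * card ?O"
    if F: "F \<in> [J]\<^bsup>l\<^esup>" and G: "G \<in> [J]\<^bsup>l\<^esup>" and A: "A \<in> [J]\<^bsup>Suc l\<^esup>"
      and FG: "F \<inter> G = {}" and nsub: "\<not> F \<subseteq> A" for F G
  proof -
    from nsub obtain v where v: "v \<in> F" "v \<notin> A" by auto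
    have j: "j \<notin> F" "j \<notin> G" "j \<notin> A" "v \<noteq> j" "v \<notin> G"
      using F G A I v FG by (auto simp: nsets_def)
    have img: "(s(v := y)) ` insert j G = s ` insert j G" "(s(v := y)) ` A = s ` A" "(s(j := y)) ` A = s ` A"
      for s :: "nat \<Rightarrow> 'a" and y using v j by auto
    have "{s \<in> ?O. s ` insert j F \<in> E \<and> s ` insert j G \<in> E \<and> s ` A \<in> E}
        = {s \<in> ?O. (s ` insert j G \<in> E \<and> s ` A \<in> E) \<and> s ` insert j F \<in> E}" by auto
    also have "card \<dots> \<le> ?\<delta> * card {s \<in> ?O. s ` insert j G \<in> E \<and> s ` A \<in> E}"
      by (rule card_PiE_edge_le[OF H deg I(1), of _ v])
        (use F I v j img in \<open>auto simp: nsets_def\<close>)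
    also have "{s \<in> ?O. s ` insert j G \<in> E \<and> s ` A \<in> E} = {s \<in> ?O. s ` A \<in> E \<and> s ` insert j G \<in> E}" by auto
    also have "?\<delta> * card \<dots> \<le> ?\<delta> * (?\<delta> * card {s \<in> ?O. s ` A \<in> E})"
      by (intro mult_left_mono card_PiE_edge_le[OF H deg I(1), of _ j])
        (use G I j img in \<open>auto simp: nsets_def\<close>)
    also have "\<dots> \<le> ?\<delta> * (?\<delta> * (?\<delta> * card {s \<in> ?O. True}))"
    proof (intro mult_left_mono)
      obtain a where "a \<in> A" using A by (cases "A = {}") (auto simp: nsets_def)
      then show "card {s \<in> ?O. s ` A \<in> E} \<le> ?\<delta> * card {s \<in> ?O. True}"
        using card_PiE_edge_le[OF H deg I(1), of A a "\<lambda>_. True"] A I by (auto simp: nsets_def)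
    qed simp_all
    finally show ?thesis by (simp add: power3_eq_cube mult.assoc)
  qed
  have FGA: "F \<in> [J]\<^bsup>l\<^esup>" "G \<in> [J]\<^bsup>l\<^esup>" "A \<in> [J]\<^bsup>Suc l\<^esup>" "F \<inter> G = {}"
    using p by (auto simp: link_triples_def)
  have "\<not> F \<subseteq> A \<or> \<not> G \<subseteq> A"
  proof (rule ccontr)
    assume "\<not> ?thesis"
    then have "card (F \<union> G) \<le> card A" using FGA by (intro card_mono) (auto simp: nsets_def)
    moreover have "card (F \<union> G) = 2 * l" "card A = Suc l"
      using FGA by (auto simp: nsets_def card_Un_disjoint)
    ultimately show False using l by simp
  qed
  then show ?thesis
  proof
    assume "\<not> F \<subseteq> A"
    then show ?thesis using peel[OF FGA(1,2,3,4)] by simp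
  next
    assume "\<not> G \<subseteq> A"
    moreover have "G \<inter> F = {}" using FGA by auto
    moreover have "{s \<in> ?O. s ` insert j F \<in> E \<and> s ` insert j G \<in> E \<and> s ` A \<in> E}
        = {s \<in> ?O. s ` insert j G \<in> E \<and> s ` insert j F \<in> E \<and> s ` A \<in> E}" by auto
    ultimately show ?thesis using peel[OF FGA(2,1,3)] by simp
  qed
qed

section \<open>Growth of the number of independent sets\<close>

lemma card_independent_le:
  assumes "finite R" "card R \<le> M" "\<And>W. independent R E W \<Longrightarrow> card W < t"
  shows "card {W. independent R E W} \<le> (M + 1) ^ t"
proof -
  have "{W. independent R E W} \<subseteq> (\<Union>i<t. [R]\<^bsup>i\<^esup>)"
    using assms by (auto simp: independent_def nsets_def intro: finite_subset)
  moreover have "finite (\<Union>i<t. [R]\<^bsup>i\<^esup>)" using assms by (simp add: finite_imp_finite_nsets)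
  ultimately have "card {W. independent R E W} \<le> card (\<Union>i<t. [R]\<^bsup>i\<^esup>)" by (rule card_mono[rotated])
  also have "\<dots> \<le> (\<Sum>i<t. card ([R]\<^bsup>i\<^esup>))" by (intro card_UN_le) simp
  also have "\<dots> \<le> (\<Sum>i<t. M ^ i)" using assms by (intro sum_mono card_nsets_le_power)
  also have "\<dots> \<le> (\<Sum>i\<le>t. (t choose i) * M ^ i)"
  proof -
    have "(\<Sum>i<t. M ^ i) \<le> (\<Sum>i\<le>t. M ^ i)" by (intro sum_mono2) auto
    also have "\<dots> \<le> (\<Sum>i\<le>t. (t choose i) * M ^ i)"
      using zero_less_binomial[of _ t] by (intro sum_mono) (auto simp: Suc_le_eq)
    finally show ?thesis .
  qed
  also have "\<dots> = (M + 1) ^ t" using binomial[of M 1 t] by simp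
  finally show ?thesis .
qed

text \<open>Double counting: link edges inside \<open>W\<close> are among its at most
  \<open>t ^ l\<close> subsets of size \<open>l\<close>, and each of these is extended to an edge by
  at most \<open>d\<close> vertices.\<close>

lemma sum_link_edges_le:
  assumes H: "r_graph (Suc l) V E" and deg: "\<And>S. S \<in> [V]\<^bsup>l\<^esup> \<Longrightarrow> deg E S \<le> d"
    and W: "finite W" "card W \<le> t"
  shows "(\<Sum>x\<in>V. card {f. f \<subseteq> W \<and> x \<notin> f \<and> insert x f \<in> E}) \<le> t ^ l * d"
proof -
  have fV: "finite V" using H by (simp add: r_graph_def)
  note N = card_nsets_le_power[OF W, of l]
  have "(\<Sum>x\<in>V. card {f. f \<subseteq> W \<and> x \<notin> f \<and> insert x f \<in> E}) \<le> (\<Sum>x\<in>V. card {f \<in> [W]\<^bsup>l\<^esup>. insert x f \<in> E})"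
  proof (intro sum_mono card_mono)
    fix x show "{f. f \<subseteq> W \<and> x \<notin> f \<and> insert x f \<in> E} \<subseteq> {f \<in> [W]\<^bsup>l\<^esup>. insert x f \<in> E}"
    proof clarify
      fix f assume f: "f \<subseteq> W" "x \<notin> f" "insert x f \<in> E"
      then have "finite f" using W by (meson finite_subset)
      moreover have "card (insert x f) = Suc l" using f H by (auto simp: r_graph_def nsets_def)
      ultimately show "f \<in> [W]\<^bsup>l\<^esup>" using f by (simp add: nsets_def)
    qed
  qed (use N in auto)
  also have "\<dots> = (\<Sum>x\<in>V. \<Sum>f\<in>[W]\<^bsup>l\<^esup>. if insert x f \<in> E then 1 else 0)"
    using N by (simp add: sum.If_cases Int_def)
  also have "\<dots> = (\<Sum>f\<in>[W]\<^bsup>l\<^esup>. \<Sum>x\<in>V. if insert x f \<in> E then 1 else 0)" by (rule sum.swap)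
  also have "\<dots> = (\<Sum>f\<in>[W]\<^bsup>l\<^esup>. card {x \<in> V. insert x f \<in> E})"
    using fV by (simp add: sum.If_cases Int_def)
  also have "\<dots> \<le> (\<Sum>f\<in>[W]\<^bsup>l\<^esup>. d)"
  proof (intro sum_mono)
    fix f assume "f \<in> [W]\<^bsup>l\<^esup>"
    moreover have "{x \<in> V. insert x f \<in> E} = {x. insert x f \<in> E}"
      using H by (auto simp: r_graph_def nsets_def)
    ultimately show "card {x \<in> V. insert x f \<in> E} \<le> d"
      using card_extensions_le[OF H deg, of f] by (simp add: nsets_def)
  qed
  also have "\<dots> \<le> t ^ l * d" using N by simp
  finally show ?thesis .
qed

text \<open>Markov's inequality over \<open>x \<in> V\<close>: the threshold is four times the bound
  on the average that follows from \<open>sum_link_edges_le\<close>.\<close>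

lemma card_heavy_le:
  assumes H: "r_graph (Suc l) V E" "V \<noteq> {}" and deg: "\<And>S. S \<in> [V]\<^bsup>l\<^esup> \<Longrightarrow> deg E S \<le> d" and d: "0 < d"
    and R: "R \<subseteq> V" and ind: "\<And>I. independent V E I \<Longrightarrow> card I < t" and t: "0 < t"
  shows "card {x \<in> V. 4 * t ^ l * d / card V * card {W. independent R E W}
      < (\<Sum>W | independent R E W. card {f. f \<subseteq> W \<and> x \<notin> f \<and> insert x f \<in> E})} \<le> 1 / 4 * card V"
proof (cases "card {W. independent R E W} = 0")
  case True
  let ?I = "{W. independent R E W}"
  have "finite ?I" using H R by (intro finite_independent) (auto simp: r_graph_def intro: finite_subset)
  with True have "?I = {}" by simp
  then show ?thesis by simp
next
  case False
  let ?\<kappa> = "4 * real t ^ l * real d / card V" and ?I = "{W. independent R E W}"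
  let ?k = "\<lambda>x. \<Sum>W\<in>?I. card {f. f \<subseteq> W \<and> x \<notin> f \<and> insert x f \<in> E}"
  have fV: "finite V" using H by (simp add: r_graph_def)
  have cV: "0 < card V" using fV H by (simp add: card_gt_0_iff)
  have pos: "0 < ?\<kappa> * card ?I" using False d t cV by (auto intro!: mult_pos_pos divide_pos_pos)
  have "?\<kappa> * card ?I * card {x \<in> V. ?\<kappa> * card ?I < ?k x} = (\<Sum>x\<in>{x \<in> V. ?\<kappa> * card ?I < ?k x}. ?\<kappa> * card ?I)"
    by simp
  also have "\<dots> \<le> (\<Sum>x\<in>{x \<in> V. ?\<kappa> * card ?I < ?k x}. real (?k x))"
    by (intro sum_mono) auto
  also have "\<dots> \<le> (\<Sum>x\<in>V. real (?k x))" using fV by (intro sum_mono2) (auto intro: sum_nonneg)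
  also have "\<dots> = real (\<Sum>W\<in>?I. \<Sum>x\<in>V. card {f. f \<subseteq> W \<and> x \<notin> f \<and> insert x f \<in> E})"
    by (subst sum.swap) simp
  also have "\<dots> \<le> real (\<Sum>W\<in>?I. t ^ l * d)"
  proof (intro of_nat_mono sum_mono sum_link_edges_le[OF H(1) deg])
    fix W assume W: "W \<in> ?I"
    then show "finite W" using R fV by (auto simp: independent_def intro: finite_subset)
    have "independent V E W" using W R by (auto simp: independent_def)
    then show "card W \<le> t" using ind by (simp add: less_imp_le)
  qed
  also have "\<dots> = ?\<kappa> * card ?I * (1 / 4 * card V)" using cV by simp
  finally show ?thesis using pos by (simp only: mult_le_cancel_left_pos)
qed

lemma card_independent_insert_mono:
  assumes "finite R"
  shows "card {W. independent R E W} \<le> card {W. independent (insert x R) E W}"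
  using assms by (intro card_mono finite_independent) (auto simp: independent_def)

text \<open>
  Vertices are sampled one at a time.  For at least half of the samples the new vertex \<open>s j\<close> satisfies
  the hypotheses of \<open>card_independent_insert\<close>, which multiplies the number of independent sets by a
  constant factor; yet that number is at most \<open>(M + 1) ^ t\<close>.
\<close>

lemma log_growth_le:
  fixes t M d :: nat
  assumes H: "r_graph (Suc l) V E" "V \<noteq> {}" and deg: "\<And>S. S \<in> [V]\<^bsup>l\<^esup> \<Longrightarrow> deg E S \<le> d"
    and d: "0 < d" and l: "2 \<le> l"
    and ind: "\<And>I. independent V E I \<Longrightarrow> card I < t" and t: "0 < t"
    and small: "M / card V + l * M ^ (2 * l - 1) * (d / card V)\<^sup>2
        + l\<^sup>2 * M ^ (3 * l - 1) * (d / card V) ^ 3 \<le> 1 / 4"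
  shows "M / 2 * ln (1 + 2 powr (- (8 * real t ^ l * real d / card V))) \<le> t * ln (M + 1)"
proof -
  let ?O = "{..<M} \<rightarrow>\<^sub>E V" and ?\<delta> = "real d / card V"
  define \<kappa> where "\<kappa> = 4 * real t ^ l * real d / card V"
  define q where "q = 2 powr (- 2 * \<kappa>)"
  define i where "i R = card {W. independent R E W}" for R
  define heavy where "heavy R x \<longleftrightarrow>
    \<kappa> * i R < (\<Sum>W | independent R E W. card {f. f \<subseteq> W \<and> x \<notin> f \<and> insert x f \<in> E})" for R x
  have fV: "finite V" using H by (simp add: r_graph_def)
  have fO: "finite ?O" using fV by (simp add: finite_PiE)
  have cO: "0 < card ?O" using fO H by (auto simp: card_gt_0_iff PiE_eq_empty_iff)
  have cE: "card e = Suc l" if "e \<in> E" for e using that H by (auto simp: r_graph_def nsets_def)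
  have ne: "{} \<notin> E" using cE by force
  \<comment> \<open>The ways in which step \<open>j\<close> can fail: a repeated vertex, two
    overlapping link edges, an edge meeting two link edges, too many link edges on average. The
    first three have total probability at most 1/4 by \<open>small\<close>, the last at most 1/4 by
    \<open>card_heavy_le\<close>.\<close>
  define B1 where "B1 j = (\<Union>i\<in>{..<j}. {s \<in> ?O. s i = s j})" for j
  define B2 where "B2 j = (\<Union>(F, G)\<in>link_pairs l {..<j}. {s \<in> ?O. s ` insert j F \<in> E \<and> s ` insert j G \<in> E})" for j
  define B3 where "B3 j = (\<Union>(F, G, A)\<in>link_triples l {..<j}.
    {s \<in> ?O. s ` insert j F \<in> E \<and> s ` insert j G \<in> E \<and> s ` A \<in> E})" for j
  define B4 where "B4 j = {s \<in> ?O. heavy (s ` {..<j}) (s j)}" for j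
  define B where "B j = B1 j \<union> B2 j \<union> B3 j \<union> B4 j" for j
  have i1: "1 \<le> i R" if "finite R" for R
  proof -
    have "{} \<in> {W. independent R E W}" using ne by (auto simp: independent_def)
    then show ?thesis using finite_independent[OF that] unfolding i_def
      by (metis One_nat_def Suc_leI card_gt_0_iff empty_iff)
  qed
  have gain: "(1 + q) * i (s ` {..<j}) \<le> i (s ` {..<Suc j})" if s: "s \<in> ?O" "s \<notin> B j" and j: "j < M" for s j
  proof -
    let ?R = "s ` {..<j}" and ?x = "s j"
    let ?L = "{f. f \<subseteq> ?R \<and> insert ?x f \<in> E}"
    \<comment> \<open>Earlier vertices may repeat in the sample, so every set of sampled vertices is
      lifted to one index set of the same size; short cycles are counted over index sets.\<close>
    define idx where "idx f = inv_into {..<j} s ` f" for f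
    have x: "?x \<notin> ?R" using s j by (auto simp: B_def B1_def)
    have idx: "s ` idx f = f" "idx f \<subseteq> {..<j}" "card (idx f) = card f" "finite (idx f)" if "f \<subseteq> ?R" for f
    proof -
      show "s ` idx f = f" unfolding idx_def using image_inv_into_cancel[OF refl that] .
      show sub: "idx f \<subseteq> {..<j}" unfolding idx_def using that inv_into_into[of _ s "{..<j}"] by blast
      show "card (idx f) = card f" unfolding idx_def
        by (intro card_image inj_on_inv_into that)
      show "finite (idx f)" using sub by (meson finite_lessThan finite_subset)
    qed
    have idx_ns: "idx f \<in> [{..<j}]\<^bsup>k\<^esup>" if "f \<subseteq> ?R" "card f = k" for f k
      using idx[OF that(1)] that(2) by (simp add: nsets_def)
    have L: "idx f \<in> [{..<j}]\<^bsup>l\<^esup>" "s ` insert j (idx f) \<in> E" if "f \<in> ?L" for f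
    proof -
      have f: "f \<subseteq> ?R" "insert ?x f \<in> E" "?x \<notin> f" using that x by auto
      have "finite f" using f by (meson finite_imageI finite_lessThan finite_subset)
      then have "card f = l" using cE[OF f(2)] f(3) by simp
      then show "idx f \<in> [{..<j}]\<^bsup>l\<^esup>" using idx_ns f by simp
      show "s ` insert j (idx f) \<in> E" using idx[OF f(1)] f by simp
    qed
    have dis: "f \<inter> g = {}" if fg: "f \<in> ?L" "g \<in> ?L" "f \<noteq> g" for f g
    proof (rule ccontr)
      assume "f \<inter> g \<noteq> {}"
      then have "idx f \<inter> idx g \<noteq> {}" by (auto simp: idx_def)
      moreover have "idx f \<noteq> idx g" using fg idx(1) by (metis (no_types, lifting) mem_Collect_eq)
      ultimately have "(idx f, idx g) \<in> link_pairs l {..<j}"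
        using L fg by (auto simp: link_pairs_def)
      then have "s \<in> B2 j" using L fg s unfolding B2_def by blast
      then show False using s by (auto simp: B_def)
    qed
    have "(1 + 2 powr (- 2 * \<kappa>)) * card {W. independent ?R E W} \<le> card {W. independent (insert ?x ?R) E W}"
    proof (rule card_independent_insert)
      show "finite ?R" by simp
      show "?x \<notin> ?R" by (rule x)
      show "{} \<notin> ?L" using cE l by force
      show "f \<inter> g = {}" if "f \<in> ?L" "g \<in> ?L" "f \<noteq> g" for f g using dis that by blast
      show "e \<inter> f = {} \<or> e \<inter> g = {}"
        if e: "e \<in> E" "e \<subseteq> ?R" and fg: "f \<in> ?L" "g \<in> ?L" "f \<noteq> g" for e f g
      proof (rule ccontr)
        assume "\<not> ?thesis"
        then have "idx e \<inter> idx f \<noteq> {}" "idx e \<inter> idx g \<noteq> {}" by (auto simp: idx_def)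
        moreover have "idx f \<inter> idx g = {}"
        proof -
          have "s ` (idx f \<inter> idx g) \<subseteq> s ` idx f \<inter> s ` idx g" by auto
          also have "\<dots> = {}" using idx(1) dis[OF fg] fg by auto
          finally show ?thesis by simp
        qed
        moreover have "idx e \<in> [{..<j}]\<^bsup>Suc l\<^esup>" using idx_ns e cE by blast
        ultimately have "(idx f, idx g, idx e) \<in> link_triples l {..<j}"
          using L fg by (auto simp: link_triples_def)
        moreover have "s ` idx e \<in> E" using idx e by simp
        ultimately have "s \<in> B3 j" using L fg s unfolding B3_def by blast
        then show False using s by (auto simp: B_def)
      qed
      have "\<not> heavy ?R ?x" using s by (auto simp: B_def B4_def)
      then have "(\<Sum>W | independent ?R E W. card {f. f \<subseteq> W \<and> ?x \<notin> f \<and> insert ?x f \<in> E}) \<le> \<kappa> * i ?R"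
        by (simp add: heavy_def)
      also have "(\<Sum>W | independent ?R E W. card {f. f \<subseteq> W \<and> ?x \<notin> f \<and> insert ?x f \<in> E})
          = (\<Sum>W | independent ?R E W. card {f \<in> ?L. f \<subseteq> W})"
        using x by (intro sum.cong refl arg_cong[where f = card]) (auto simp: independent_def)
      finally show "real (\<Sum>W | independent ?R E W. card {f \<in> ?L. f \<subseteq> W}) \<le> \<kappa> * card {W. independent ?R E W}"
        by (simp add: i_def)
    qed
    then show ?thesis by (simp add: i_def q_def lessThan_Suc)
  qed
  have bad: "card (B j) \<le> 1 / 2 * card ?O" if j: "j < M" for j
  proof -
    have c1: "card (B1 j) \<le> M / card V * card ?O"
    proof -
      have "card (B1 j) \<le> (\<Sum>i<j. card {s \<in> ?O. s i = s j})" unfolding B1_def by (intro card_UN_le) simp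
      also have "real \<dots> = (\<Sum>i<j. real (card {s \<in> ?O. s i = s j}))" by simp
      also have "\<dots> \<le> (\<Sum>i<j. 1 / card V * card ?O)"
        using j fV H by (intro sum_mono card_PiE_coincide) auto
      also have "\<dots> = j * (1 / card V * card ?O)" by simp
      also have "\<dots> \<le> M * (1 / card V * card ?O)" using j by (intro mult_right_mono) auto
      finally show ?thesis by simp
    qed
    have c2: "card (B2 j) \<le> l * M ^ (2 * l - 1) * ?\<delta>\<^sup>2 * card ?O"
    proof -
      have P: "finite (link_pairs l {..<j})" "card (link_pairs l {..<j}) \<le> l * M ^ (2 * l - 1)"
        using card_link_pairs[of "{..<j}" M l] j l by auto
      have "card (B2 j) \<le> (\<Sum>p\<in>link_pairs l {..<j}.
          card (case p of (F, G) \<Rightarrow> {s \<in> ?O. s ` insert j F \<in> E \<and> s ` insert j G \<in> E}))"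
        unfolding B2_def using P by (intro card_UN_le)
      also have "real \<dots> \<le> (\<Sum>p\<in>link_pairs l {..<j}. ?\<delta>\<^sup>2 * card ?O)"
        unfolding of_nat_sum
      proof (intro sum_mono)
        fix p assume p: "p \<in> link_pairs l {..<j}"
        obtain F G where FG: "p = (F, G)" by (cases p)
        show "real (card (case p of (F, G) \<Rightarrow> {s \<in> ?O. s ` insert j F \<in> E \<and> s ` insert j G \<in> E})) \<le> ?\<delta>\<^sup>2 * card ?O"
          using card_PiE_link_pair[OF H deg, of "{..<M}" "{..<j}" j F G] p FG j by auto
      qed
      also have "\<dots> = real (card (link_pairs l {..<j})) * (?\<delta>\<^sup>2 * card ?O)" by simp
      also have "\<dots> \<le> real (l * M ^ (2 * l - 1)) * (?\<delta>\<^sup>2 * card ?O)"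
        using P(2) by (intro mult_right_mono of_nat_mono) auto
      finally show ?thesis by (simp add: mult.assoc)
    qed
    have c3: "card (B3 j) \<le> l\<^sup>2 * M ^ (3 * l - 1) * ?\<delta> ^ 3 * card ?O"
    proof -
      have P: "finite (link_triples l {..<j})" "card (link_triples l {..<j}) \<le> l\<^sup>2 * M ^ (3 * l - 1)"
        using card_link_triples[of "{..<j}" M l] j l by auto
      have "card (B3 j) \<le> (\<Sum>p\<in>link_triples l {..<j}.
          card (case p of (F, G, A) \<Rightarrow> {s \<in> ?O. s ` insert j F \<in> E \<and> s ` insert j G \<in> E \<and> s ` A \<in> E}))"
        unfolding B3_def using P by (intro card_UN_le)
      also have "real \<dots> \<le> (\<Sum>p\<in>link_triples l {..<j}. ?\<delta> ^ 3 * card ?O)"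
        unfolding of_nat_sum
      proof (intro sum_mono)
        fix p assume p: "p \<in> link_triples l {..<j}"
        obtain F G A where FG: "p = (F, G, A)" by (cases p)
        show "real (card (case p of (F, G, A) \<Rightarrow> {s \<in> ?O. s ` insert j F \<in> E \<and> s ` insert j G \<in> E \<and> s ` A \<in> E}))
            \<le> ?\<delta> ^ 3 * card ?O"
          using card_PiE_link_triple[OF H deg l, of "{..<M}" "{..<j}" j F G A] p FG j by auto
      qed
      also have "\<dots> = real (card (link_triples l {..<j})) * (?\<delta> ^ 3 * card ?O)" by simp
      also have "\<dots> \<le> real (l\<^sup>2 * M ^ (3 * l - 1)) * (?\<delta> ^ 3 * card ?O)"
        using P(2) by (intro mult_right_mono of_nat_mono) auto
      finally show ?thesis by (simp add: mult.assoc)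
    qed
    have c4: "card (B4 j) \<le> 1 / 4 * card ?O"
    proof -
      have "real (card (B4 j)) = (\<Sum>s\<in>?O. 1 * (if heavy (s ` {..<j}) (s j) then 1 else 0))"
        unfolding B4_def using fO by (simp add: sum.If_cases Int_def)
      also have "\<dots> \<le> 1 / 4 * (\<Sum>s\<in>?O. 1)"
      proof (rule sum_PiE_coordinate_le[of j])
        fix s assume s: "s \<in> ?O"
        have img: "(s(j := y)) ` {..<j} = s ` {..<j}" for y by (intro image_cong refl) simp
        have R: "s ` {..<j} \<subseteq> V"
          using j by (intro image_subsetI PiE_mem[OF s]) simp
        have "(\<Sum>y\<in>V. if heavy ((s(j := y)) ` {..<j}) ((s(j := y)) j) then 1 else 0 :: real)
            = card {y \<in> V. heavy (s ` {..<j}) y}"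
          unfolding img using fV by (simp add: sum.If_cases Int_def)
        also have "\<dots> \<le> 1 / 4 * card V"
          unfolding heavy_def i_def \<kappa>_def by (rule card_heavy_le[OF H deg d R ind t])
        finally show "(\<Sum>y\<in>V. if heavy ((s(j := y)) ` {..<j}) ((s(j := y)) j) then 1 else 0 :: real)
            \<le> 1 / 4 * card V" .
      qed (use j fV H in auto)
      finally show ?thesis by simp
    qed
    have "card (B j) \<le> card (B1 j) + card (B2 j) + card (B3 j) + card (B4 j)"
      unfolding B_def by (meson add_mono card_Un_le order_refl order_trans)
    then have "real (card (B j)) \<le> real (card (B1 j)) + real (card (B2 j)) + real (card (B3 j)) + real (card (B4 j))"
      by linarith
    also have "\<dots> \<le> M / card V * card ?O + l * M ^ (2 * l - 1) * ?\<delta>\<^sup>2 * card ?O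
        + l\<^sup>2 * M ^ (3 * l - 1) * ?\<delta> ^ 3 * card ?O + 1 / 4 * card ?O"
      by (intro add_mono c1 c2 c3 c4)
    also have "\<dots> = (M / card V + l * M ^ (2 * l - 1) * ?\<delta>\<^sup>2 + l\<^sup>2 * M ^ (3 * l - 1) * ?\<delta> ^ 3) * card ?O
        + 1 / 4 * card ?O" by (simp add: algebra_simps)
    also have "\<dots> \<le> 1 / 4 * card ?O + 1 / 4 * card ?O"
      by (intro add_right_mono mult_right_mono[OF small]) simp
    finally show ?thesis by simp
  qed
  have lnq: "0 \<le> ln (1 + q)" by (simp add: q_def)
  have step: "ln (i (s ` {..<Suc j})) - ln (i (s ` {..<j})) \<ge> (if s \<in> B j then 0 else ln (1 + q))"
    if s: "s \<in> ?O" and j: "j < M" for s j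
  proof (cases "s \<in> B j")
    case True
    have "i (s ` {..<j}) \<le> i (s ` {..<Suc j})"
      unfolding i_def lessThan_Suc image_insert by (rule card_independent_insert_mono) simp
    then show ?thesis using True i1[of "s ` {..<j}"] by simp
  next
    case False
    have pos: "0 < real (i (s ` {..<j}))" using i1[of "s ` {..<j}"] by simp
    have q0: "0 < 1 + q" by (simp add: q_def add_pos_pos)
    have "ln (1 + q) + ln (i (s ` {..<j})) = ln ((1 + q) * i (s ` {..<j}))"
      using pos q0 by (simp add: ln_mult)
    also have "\<dots> \<le> ln (i (s ` {..<Suc j}))"
      using gain[OF s False j] pos q0 by (intro ln_mono) auto
    finally show ?thesis using False by simp
  qed
  \<comment> \<open>Sum the logarithmic gains over samples and steps. At each step at least half of
    the samples gain \<open>ln (1 + q)\<close>; for a fixed sample the gains telescope.\<close>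
  have "card ?O * (M / 2 * ln (1 + q)) = (\<Sum>j<M. 1 / 2 * card ?O * ln (1 + q))" by simp
  also have "\<dots> \<le> (\<Sum>j<M. real (card (?O - B j)) * ln (1 + q))"
  proof (intro sum_mono mult_right_mono lnq)
    fix j assume "j \<in> {..<M}"
    moreover have sub: "B j \<subseteq> ?O" by (auto simp: B_def B1_def B2_def B3_def B4_def)
    ultimately show "1 / 2 * card ?O \<le> real (card (?O - B j))"
      using bad[of j] card_mono[OF fO sub] by (simp add: card_Diff_subset finite_subset[OF sub fO] of_nat_diff)
  qed
  also have "\<dots> = (\<Sum>j<M. \<Sum>s\<in>?O. if s \<in> B j then 0 else ln (1 + q))"
    using fO by (simp add: sum.If_cases Diff_eq)
  also have "\<dots> \<le> (\<Sum>j<M. \<Sum>s\<in>?O. ln (i (s ` {..<Suc j})) - ln (i (s ` {..<j})))"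
    by (intro sum_mono step) auto
  also have "\<dots> = (\<Sum>s\<in>?O. \<Sum>j<M. ln (i (s ` {..<Suc j})) - ln (i (s ` {..<j})))"
    by (rule sum.swap)
  also have "\<dots> = (\<Sum>s\<in>?O. ln (i (s ` {..<M})) - ln (i (s ` {..<0})))"
    using sum_lessThan_telescope[of "\<lambda>j. ln (real (i (s ` {..<j})))" M for s] by (intro sum.cong refl)
  also have "\<dots> \<le> (\<Sum>s\<in>?O. t * ln (M + 1))"
  proof (intro sum_mono)
    fix s assume s: "s \<in> ?O"
    have "i (s ` {..<M}) \<le> (M + 1) ^ t" unfolding i_def
    proof (rule card_independent_le)
      show "card (s ` {..<M}) \<le> M" using card_image_le[of "{..<M}" s] by simp
      show "card W < t" if "independent (s ` {..<M}) E W" for W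
        using that s by (intro ind) (auto simp: independent_def)
    qed simp
    then have "real (i (s ` {..<M})) \<le> real (M + 1) ^ t" by (metis of_nat_le_iff of_nat_power)
    then have "ln (i (s ` {..<M})) \<le> ln (real (M + 1) ^ t)"
      using i1[of "s ` {..<M}"] by (intro ln_mono) auto
    also have "\<dots> = t * ln (M + 1)" by (simp add: ln_realpow)
    finally show "ln (i (s ` {..<M})) - ln (i (s ` {..<0})) \<le> t * ln (M + 1)"
      using i1[of "s ` {..<0}"] by (smt (verit) ln_ge_zero finite_imageI finite_lessThan of_nat_1 of_nat_le_iff)
  qed
  also have "\<dots> = card ?O * (t * ln (M + 1))" by simp
  finally have "M / 2 * ln (1 + q) \<le> t * ln (M + 1)" using cO by (simp only: mult_le_cancel_left_pos of_nat_0_less_iff)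
  moreover have "- 2 * \<kappa> = - (8 * real t ^ l * real d / card V)" by (simp add: \<kappa>_def)
  ultimately show ?thesis by (simp add: q_def)
qed

section \<open>The lower bound\<close>

lemma tau_le_one:
  assumes "Suc l \<le> t"
  shows "tau l t (Suc l) \<le> 1"
proof (rule tendsto_upperbound[OF T_min_ratio_tendsto_tau[OF assms]])
  show "\<forall>\<^sub>F n in sequentially. real (T_min l n t (Suc l)) / n \<le> 1"
    using eventually_ge_at_top[of "max 1 l"]
    by eventually_elim (use T_min_le_self[OF assms] in auto)
qed simp

text \<open>Carries the lower bound from one large \<open>t\<close> back to the finitely many small
  ones.\<close>

lemma tau_antimono:
  assumes "Suc l \<le> t" "t \<le> t'"
  shows "tau l t' (Suc l) \<le> tau l t (Suc l)"
proof (rule tendsto_le[OF _ T_min_ratio_tendsto_tau T_min_ratio_tendsto_tau])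
  show "\<forall>\<^sub>F n in sequentially. real (T_min l n t' (Suc l)) / n \<le> real (T_min l n t (Suc l)) / n"
    using eventually_ge_at_top[of l]
    by eventually_elim (use T_min_mono[OF _ assms] in \<open>auto intro!: divide_right_mono\<close>)
qed (use assms in auto)

lemma ln_one_plus_ge_half:
  fixes q :: real
  assumes "0 \<le> q" "q \<le> 1"
  shows "q / 2 \<le> ln (1 + q)"
proof -
  have "q / 2 \<le> q / (1 + q)" using assms by (intro divide_left_mono) auto
  also have "\<dots> = 1 - inverse (1 + q)" using assms by (simp add: field_simps)
  also have "\<dots> \<le> ln (1 + q)" using ln_le_minus_one[of "inverse (1 + q)"] assms by (simp add: ln_inverse)
  finally show ?thesis .
qed

text \<open>\<open>M\<close> is about t^(1 + \<theta>) with \<open>l * \<theta> = 1 / 8\<close>, so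
  \<open>M ^ l * \<beta>\<close> is at most \<open>Y t\<close>, of order t^(1/8) ln t. The cycle
  terms of \<open>log_growth_le\<close> are at most constants times Y^2 / t and Y^3 / t, which tend
  to 0 since 3/8 < 1.\<close>

lemma tau_lower_eventually:
  assumes l: "2 \<le> l"
  defines "\<theta> \<equiv> 1 / (8 * real l)"
  shows "\<forall>\<^sub>F t in sequentially. \<theta> / 16 * (ln (real t) / real t ^ l) \<le> tau l t (Suc l)"
proof -
  have th: "0 < \<theta>" "l * \<theta> = 1 / 8" "\<theta> \<le> 1" using l by (auto simp: \<theta>_def)
  \<comment> \<open>Then \<open>8 * t ^ l * \<beta> = \<theta> / 2 * ln t\<close>, so the proportion
    \<open>q\<close> is at least t^(-\<theta>/2), and half of the extra exponent \<theta> of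
    \<open>M\<close> survives.\<close>
  define c where "c = \<theta> / 16"
  have c: "0 < c" using th by (simp add: c_def)
  define Y where "Y t = 2 ^ l * c * t powr (1 / 8) * ln t" for t :: real
  have "((\<lambda>t::real. l * (Y t ^ 2 / t) + l\<^sup>2 * (Y t ^ 3 / t)) \<longlongrightarrow> 0) at_top"
  proof -
    let ?Z = "\<lambda>t::real. t powr (1 / 8) * ln t"
    have "((\<lambda>t. ?Z t ^ 2 / t) \<longlongrightarrow> 0) at_top" "((\<lambda>t. ?Z t ^ 3 / t) \<longlongrightarrow> 0) at_top"
      by real_asymp+
    then have "((\<lambda>t. l * (2 ^ l * c) ^ 2 * (?Z t ^ 2 / t) + l\<^sup>2 * (2 ^ l * c) ^ 3 * (?Z t ^ 3 / t))
        \<longlongrightarrow> l * (2 ^ l * c) ^ 2 * 0 + l\<^sup>2 * (2 ^ l * c) ^ 3 * 0) at_top"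
      by (intro tendsto_intros)
    moreover have "(\<lambda>t. l * (2 ^ l * c) ^ 2 * (?Z t ^ 2 / t) + l\<^sup>2 * (2 ^ l * c) ^ 3 * (?Z t ^ 3 / t))
        = (\<lambda>t. l * (Y t ^ 2 / t) + l\<^sup>2 * (Y t ^ 3 / t))"
      by (simp add: Y_def power_mult_distrib fun_eq_iff mult_ac)
    ultimately show ?thesis by simp
  qed
  then have "\<forall>\<^sub>F t::real in at_top. l * (Y t ^ 2 / t) + l\<^sup>2 * (Y t ^ 3 / t) < 1 / 8"
    by (rule order_tendstoD) simp
  moreover have "\<forall>\<^sub>F t::real in at_top. ln (2 * t powr (1 + \<theta>) + 1) < t powr (\<theta> / 2) / 4"
    using th(1) by real_asymp
  moreover have "\<forall>\<^sub>F t::real in at_top. real (Suc l) \<le> t" by (rule eventually_ge_at_top)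
  ultimately have "\<forall>\<^sub>F t::real in at_top. l * (Y t ^ 2 / t) + l\<^sup>2 * (Y t ^ 3 / t) < 1 / 8 \<and>
      ln (2 * t powr (1 + \<theta>) + 1) < t powr (\<theta> / 2) / 4 \<and> real (Suc l) \<le> t"
    by eventually_elim auto
  then have "\<forall>\<^sub>F t in sequentially. l * (Y (real t) ^ 2 / t) + l\<^sup>2 * (Y (real t) ^ 3 / t) < 1 / 8 \<and>
      ln (2 * real t powr (1 + \<theta>) + 1) < real t powr (\<theta> / 2) / 4 \<and> Suc l \<le> t"
    using filterlim_real_sequentially unfolding filterlim_iff of_nat_le_iff[where ?'a = real, symmetric] by blast
  then show ?thesis
  proof eventually_elim
    case (elim t)
    note Y_small = conjunct1[OF elim] and ln_small = conjunct1[OF conjunct2[OF elim]]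
    have tl: "Suc l \<le> t" and t3: "3 \<le> t" and t1: "1 < real t" using elim l by auto
    define \<beta> where "\<beta> = c * (ln (real t) / real t ^ l)"
    have b0: "0 < \<beta>" using c t1 by (simp add: \<beta>_def)
    define M where "M = nat \<lceil>real t powr (1 + \<theta>)\<rceil>"
    have tp: "real t \<le> real t powr (1 + \<theta>)" using powr_mono[of 1 "1 + \<theta>" t] th t1 by simp
    then have M: "real t powr (1 + \<theta>) \<le> M" "M \<le> 2 * real t powr (1 + \<theta>)" "real t \<le> M" "0 < real M"
      using t1 unfolding M_def by linarith+
    have M_Y: "real M ^ l * \<beta> \<le> Y t"
    proof -
      have "real M ^ l \<le> (2 * real t powr (1 + \<theta>)) ^ l" using M by (intro power_mono) auto
      also have "\<dots> = 2 ^ l * real t powr (l * (1 + \<theta>))"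
        using t1 by (simp add: power_mult_distrib powr_realpow[symmetric] powr_powr mult.commute)
      also have "l * (1 + \<theta>) = l + 1 / 8" using th by (simp add: distrib_left)
      also have "real t powr (l + 1 / 8) = real t ^ l * real t powr (1 / 8)"
        using t1 by (simp add: powr_add powr_realpow)
      finally have "real M ^ l * \<beta> \<le> 2 ^ l * (real t ^ l * real t powr (1 / 8)) * \<beta>"
        using b0 by (intro mult_right_mono) auto
      also have "\<dots> = Y t" using t1 by (simp add: \<beta>_def Y_def)
      finally show ?thesis .
    qed
    have "\<forall>\<^sub>F n in sequentially. real M / real n < 1 / 8" by real_asymp
    moreover have "\<forall>\<^sub>F n in sequentially. 1 / real n < \<beta>" using b0 by real_asymp
    moreover have "\<forall>\<^sub>F n in sequentially. max 1 l \<le> n" by (rule eventually_ge_at_top)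
    ultimately have "\<forall>\<^sub>F n in sequentially. \<beta> \<le> real (T_min l n t (Suc l)) / n"
    proof eventually_elim
      case (elim n)
      show ?case
      proof (rule ccontr)
        assume neg: "\<not> \<beta> \<le> real (T_min l n t (Suc l)) / n"
        \<comment> \<open>\<open>log_growth_le\<close> asks for a positive codegree bound; for large
          \<open>n\<close> the value 1 is below \<open>\<beta> * n\<close> as well.\<close>
        define d where "d = max 1 (T_min l n t (Suc l))"
        define \<delta> where "\<delta> = real d / n"
        have \<delta>: "0 < \<delta>" "\<delta> \<le> \<beta>" using neg elim by (auto simp: \<delta>_def d_def max_def)
        have "l \<le> n" using elim by simp
        then obtain V :: "nat set" and E where H: "r_graph (Suc l) V E" "card V = n"
          "\<And>I. independent V E I \<Longrightarrow> card I < t" "\<And>S. S \<in> [V]\<^bsup>l\<^esup> \<Longrightarrow> deg E S \<le> T_min l n t (Suc l)"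
          using T_min_witness[OF zero_less_Suc tl, of l n] by metis
        have deg: "deg E S \<le> d" if "S \<in> [V]\<^bsup>l\<^esup>" for S using H(4)[OF that] by (simp add: d_def)
        have V: "V \<noteq> {}" using H(2) elim by auto
        have D: "real M ^ l * \<delta> \<le> Y t"
          using M_Y mult_left_mono[OF \<delta>(2), of "real M ^ l"] by simp
        have pw: "real M ^ (k * l - 1) * \<delta> ^ k \<le> Y t ^ k / t" if "1 \<le> k" for k
        proof -
          have "1 \<le> k * l" using that l by simp
          then have "real M ^ (k * l - 1) * \<delta> ^ k = (real M ^ l * \<delta>) ^ k / M"
            using M(4) by (simp add: power_diff power_mult_distrib power_mult[symmetric] mult.commute)
          also have "\<dots> \<le> Y t ^ k / M"
            using D \<delta> M by (intro divide_right_mono power_mono) auto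
          also have "\<dots> \<le> Y t ^ k / t"
          proof (intro divide_left_mono)
            have "0 \<le> real M ^ l * \<delta>" using \<delta> by simp
            then show "0 \<le> Y t ^ k" using D by (intro zero_le_power) linarith
          qed (use M t1 in auto)
          finally show ?thesis .
        qed
        have "M / card V + l * M ^ (2 * l - 1) * (d / card V)\<^sup>2 + l\<^sup>2 * M ^ (3 * l - 1) * (d / card V) ^ 3
            = M / n + (l * (real M ^ (2 * l - 1) * \<delta>\<^sup>2) + l\<^sup>2 * (real M ^ (3 * l - 1) * \<delta> ^ 3))"
          by (simp add: H(2) \<delta>_def)
        also have "\<dots> \<le> 1 / 8 + (l * (Y t ^ 2 / t) + l\<^sup>2 * (Y t ^ 3 / t))"
          using elim by (intro add_mono mult_left_mono pw) auto
        also have "\<dots> \<le> 1 / 4"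
          using Y_small by linarith
        finally have "M / 2 * ln (1 + 2 powr (- (8 * real t ^ l * real d / card V))) \<le> t * ln (M + 1)"
          using t3 l by (intro log_growth_le[OF H(1) V deg _ _ H(3)]) (auto simp: d_def)
        moreover have "8 * real t ^ l * real d / card V = 8 * real t ^ l * \<delta>" by (simp add: H(2) \<delta>_def)
        ultimately have growth: "M / 2 * ln (1 + 2 powr (- (8 * real t ^ l * \<delta>))) \<le> t * ln (M + 1)"
          by simp
        define q where "q = 2 powr (- (8 * real t ^ l * \<delta>))"
        have "8 * real t ^ l * \<delta> * ln 2 \<le> 8 * real t ^ l * \<beta> * 1"
          using \<delta> b0 ln_le_minus_one[of "2 :: real"] by (intro mult_mono) auto
        also have "\<dots> = \<theta> / 2 * ln t" using t1 by (simp add: \<beta>_def c_def)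
        finally have "- (\<theta> / 2) * ln t \<le> - (8 * real t ^ l * \<delta>) * ln 2" by simp
        then have q: "real t powr (- (\<theta> / 2)) \<le> q" using t1 by (simp add: q_def powr_def)
        have q1: "q \<le> 1" using \<delta> powr_mono[of "- (8 * real t ^ l * \<delta>)" 0 2] by (simp add: q_def)
        \<comment> \<open>The guaranteed growth of order t^(1 + \<theta>/2) exceeds
          \<open>t * ln (M + 1)\<close>, which is only t times a logarithm.\<close>
        have "real t * (real t powr (\<theta> / 2) / 4) = real t powr (1 + \<theta>) * real t powr (- (\<theta> / 2)) / 4"
          using t1 by (simp add: powr_add[symmetric] powr_mult_base add.commute)
        also have "\<dots> \<le> M * q / 4" using M q by (intro divide_right_mono mult_mono) auto
        also have "\<dots> \<le> M / 2 * ln (1 + q)"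
          using ln_one_plus_ge_half[of q] q1 mult_left_mono[of "q / 2" "ln (1 + q)" "M / 2"] by (simp add: q_def)
        also have "\<dots> \<le> t * ln (M + 1)" using growth by (simp add: q_def)
        also have "\<dots> \<le> t * ln (2 * real t powr (1 + \<theta>) + 1)"
          using M by (intro mult_left_mono ln_mono) auto
        also have "\<dots> < t * (real t powr (\<theta> / 2) / 4)"
          using ln_small t1
          by (intro mult_strict_left_mono) auto
        finally show False by simp
      qed
    qed
    then have "\<beta> \<le> tau l t (Suc l)"
      using tl by (intro tendsto_lowerbound[OF T_min_ratio_tendsto_tau]) auto
    then show ?case by (simp add: \<beta>_def c_def)
  qed
qed

lemma ln_over_power_le_one:
  assumes "1 \<le> t" "1 \<le> l"
  shows "ln (real t) / real t ^ l \<le> 1"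
proof -
  have "ln (real t) \<le> real t" using ln_le_minus_one[of t] assms by simp
  also have "\<dots> \<le> real t ^ l" using assms power_increasing[of 1 l "real t"] by simp
  finally show ?thesis using assms by simp
qed

lemma tau_lower:
  assumes l: "2 \<le> l"
  shows "\<exists>c>0. \<forall>t>Suc l. c * (ln (real t) / real t ^ l) \<le> tau l t (Suc l)"
proof -
  define c where "c = 1 / (8 * real l) / 16"
  have c: "0 < c" using l by (simp add: c_def)
  obtain t0 where t0: "\<And>t. t \<ge> t0 \<Longrightarrow> c * (ln (real t) / real t ^ l) \<le> tau l t (Suc l)"
    using tau_lower_eventually[OF l] unfolding c_def eventually_sequentially by blast
  \<comment> \<open>At least 2, so that \<open>ln t1\<close> and hence \<open>b\<close> are
    positive. For \<open>t < t0\<close> the value of \<open>tau\<close> is at least that at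
    \<open>t1\<close>, thus at least \<open>b\<close>.\<close>
  define t1 where "t1 = max t0 2"
  define b where "b = c * (ln (real t1) / real t1 ^ l)"
  have "1 < real t1" by (simp add: t1_def)
  then have b: "0 < b" using c unfolding b_def by (intro mult_pos_pos divide_pos_pos) auto
  show ?thesis
  proof (intro exI[of _ "min c b"] conjI allI impI)
    fix t assume t: "Suc l < t"
    have pos: "0 \<le> ln (real t) / real t ^ l" using t by simp
    show "min c b * (ln (real t) / real t ^ l) \<le> tau l t (Suc l)"
    proof (cases "t0 \<le> t")
      case True
      then show ?thesis using t0[OF True] pos mult_right_mono[of "min c b" c] by fastforce
    next
      case False
      have "min c b * (ln (real t) / real t ^ l) \<le> b * 1"
        using pos b c l t ln_over_power_le_one[of t l] by (intro mult_mono) auto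
      also have "\<dots> \<le> tau l t1 (Suc l)" using t0[of t1] by (simp add: b_def t1_def)
      also have "\<dots> \<le> tau l t (Suc l)" using False t by (intro tau_antimono) (auto simp: t1_def)
      finally show ?thesis .
    qed
  qed (use b c in auto)
qed

section \<open>Random hypergraphs and blow-ups\<close>

text \<open>The values of a uniformly random function are independent. This is applied with nonzero
  values (no edges on \<open>K\<close>) and with the value 0 (all of \<open>K\<close> are
  edges).\<close>

lemma card_PiE_restricted:
  assumes "finite A" "K \<subseteq> A" "Y \<subseteq> X" "finite X" "X \<noteq> {}"
  shows "card {f \<in> A \<rightarrow>\<^sub>E X. \<forall>e\<in>K. f e \<in> Y} = (card Y / card X) ^ card K * card (A \<rightarrow>\<^sub>E X)"
proof -
  have fK: "finite K" using assms by (meson finite_subset)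
  have "{f \<in> A \<rightarrow>\<^sub>E X. \<forall>e\<in>K. f e \<in> Y} = (\<Pi>\<^sub>E e\<in>A. if e \<in> K then Y else X)"
  proof (intro set_eqI iffI)
    fix f assume f: "f \<in> (\<Pi>\<^sub>E e\<in>A. if e \<in> K then Y else X)"
    have "f e \<in> X" if "e \<in> A" for e using PiE_mem[OF f that] assms(3) by (auto split: if_splits)
    moreover have "f e \<in> Y" if "e \<in> K" for e using PiE_mem[OF f, of e] that assms(2) by auto
    ultimately show "f \<in> {f \<in> A \<rightarrow>\<^sub>E X. \<forall>e\<in>K. f e \<in> Y}" using f by (auto simp: PiE_iff)
  qed (auto simp: PiE_iff)
  then have "card {f \<in> A \<rightarrow>\<^sub>E X. \<forall>e\<in>K. f e \<in> Y} = (\<Prod>e\<in>A. card (if e \<in> K then Y else X))"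
    using assms by (simp add: card_PiE)
  also have "\<dots> = card Y ^ card K * card X ^ card (A - K)"
    using assms fK by (subst prod.subset_diff[of K A]) (auto simp: mult.commute)
  finally have count: "card {f \<in> A \<rightarrow>\<^sub>E X. \<forall>e\<in>K. f e \<in> Y} = card Y ^ card K * card X ^ card (A - K)" .
  have "card A = card K + card (A - K)"
    using assms fK card_mono[OF assms(1,2)] by (simp add: card_Diff_subset)
  then have "card (A \<rightarrow>\<^sub>E X) = card X ^ card K * card X ^ card (A - K)"
    using assms by (simp add: card_PiE power_add)
  then show ?thesis using assms unfolding count by (simp add: power_divide card_gt_0_iff)
qed

text \<open>
  Union bound for the zero set of a uniformly random \<open>f : [{..<m}]\<^bsup>Suc l\<^esup> \<rightarrow> {..<Q}\<close>: the two summands bound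
  the probabilities of an independent \<open>s\<close>-set and of an \<open>l\<close>-set of degree at least \<open>k\<close>.
\<close>

lemma random_r_graph:
  fixes Q m s l k :: nat
  assumes Q: "0 < Q"
    and small: "(m choose s) * (1 - 1 / Q) ^ (s choose Suc l) + (m choose l) * ((m choose k) * (1 / Q) ^ k) < 1"
  obtains E where "r_graph (Suc l) {..<m} E" "\<And>I. independent {..<m} E I \<Longrightarrow> card I < s"
    "\<And>S. S \<in> [{..<m}]\<^bsup>l\<^esup> \<Longrightarrow> deg E S \<le> k"
proof -
  let ?A = "[{..<m}]\<^bsup>Suc l\<^esup>" and ?X = "{..<Q}"
  let ?O = "?A \<rightarrow>\<^sub>E ?X"
  let ?NS = "[{..<m}]\<^bsup>s\<^esup>" and ?NL = "[{..<m}]\<^bsup>l\<^esup>" and ?NK = "[{..<m}]\<^bsup>k\<^esup>"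
  have fA: "finite ?A" and fNS: "finite ?NS" and fNL: "finite ?NL" and fNK: "finite ?NK"
    by (simp_all add: finite_imp_finite_nsets)
  have X: "finite ?X" "?X \<noteq> {}" "card ?X = Q" using Q by auto
  have fO: "finite ?O" using fA by (simp add: finite_PiE)
  have cO: "0 < card ?O" using fO X by (auto simp: card_gt_0_iff PiE_eq_empty_iff)
  define B where "B I = {f \<in> ?O. \<forall>e\<in>[I]\<^bsup>Suc l\<^esup>. f e \<in> {1..<Q}}" for I
  \<comment> \<open>The guard keeps the \<open>K\<close> that yield \<open>k\<close> distinct
    members of \<open>?A\<close>, for which the probability is exactly \<open>(1 / Q) ^ k\<close>;
    for all others the event is empty.\<close>
  define C where "C S K = (if (\<lambda>y. insert y S) ` K \<subseteq> ?A \<and> inj_on (\<lambda>y. insert y S) K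
      then {f \<in> ?O. \<forall>e\<in>(\<lambda>y. insert y S) ` K. f e \<in> {0}} else {})" for S K
  have cB: "card (B I) = (1 - 1 / Q) ^ (s choose Suc l) * card ?O" if "I \<in> ?NS" for I
  proof -
    have "real (card (B I)) = (card {1..<Q} / card ?X) ^ card ([I]\<^bsup>Suc l\<^esup>) * card ?O"
      unfolding B_def using that fA X
      by (intro card_PiE_restricted) (auto simp: nsets_def)
    moreover have "real (card {1..<Q}) / card ?X = 1 - 1 / Q" using Q by (simp add: of_nat_diff field_simps)
    moreover have "card ([I]\<^bsup>Suc l\<^esup>) = s choose Suc l" using that by (simp add: nsets_def card_nsets[unfolded nsets_def])
    ultimately show ?thesis by simp
  qed
  have cC: "card (C S K) \<le> (1 / Q) ^ k * card ?O" if "K \<in> ?NK" for S K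
  proof (cases "(\<lambda>y. insert y S) ` K \<subseteq> ?A \<and> inj_on (\<lambda>y. insert y S) K")
    case True
    then have CSK: "C S K = {f \<in> ?O. \<forall>e\<in>(\<lambda>y. insert y S) ` K. f e \<in> {0}}"
      unfolding C_def by (rule if_P)
    have "real (card (C S K)) = (card {0::nat} / card ?X) ^ card ((\<lambda>y. insert y S) ` K) * card ?O"
      unfolding CSK using True fA X Q by (intro card_PiE_restricted) auto
    moreover have "card ((\<lambda>y. insert y S) ` K) = k" using True that by (simp add: card_image nsets_def)
    ultimately show ?thesis by simp
  next
    case False
    then show ?thesis by (auto simp: C_def)
  qed
  let ?U = "(\<Union>I\<in>?NS. B I) \<union> (\<Union>S\<in>?NL. \<Union>K\<in>?NK. C S K)"
  have "card ?U \<le> (\<Sum>I\<in>?NS. card (B I)) + (\<Sum>S\<in>?NL. \<Sum>K\<in>?NK. card (C S K))"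
    by (intro order_trans[OF card_Un_le] add_mono card_UN_le fNS
        order_trans[OF card_UN_le] sum_mono fNL fNK)
  then have "real (card ?U) \<le> (\<Sum>I\<in>?NS. real (card (B I))) + (\<Sum>S\<in>?NL. \<Sum>K\<in>?NK. real (card (C S K)))"
    by (simp flip: of_nat_sum of_nat_add)
  also have "\<dots> \<le> (\<Sum>I\<in>?NS. (1 - 1 / Q) ^ (s choose Suc l) * card ?O) + (\<Sum>S\<in>?NL. \<Sum>K\<in>?NK. (1 / Q) ^ k * card ?O)"
    using cB cC by (intro add_mono sum_mono) auto
  also have "\<dots> = ((m choose s) * (1 - 1 / Q) ^ (s choose Suc l) + (m choose l) * ((m choose k) * (1 / Q) ^ k)) * card ?O"
    by (simp add: card_nsets algebra_simps)
  also have "\<dots> < card ?O" using mult_strict_right_mono[OF small, of "card ?O"] cO by simp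
  finally have lt: "card ?U < card ?O" by simp
  have "?U \<subseteq> ?O" unfolding B_def C_def by (auto split: if_splits)
  then obtain f where f: "f \<in> ?O" "f \<notin> ?U" using lt by (metis less_irrefl subsetI subset_antisym)
  define E where "E = {e \<in> ?A. f e = 0}"
  have H: "r_graph (Suc l) {..<m} E" by (auto simp: r_graph_def E_def)
  show ?thesis
  proof (rule that[OF H])
    fix I assume I: "independent {..<m} E I"
    show "card I < s"
    proof (rule ccontr)
      assume "\<not> card I < s"
      then obtain J where J: "J \<subseteq> I" "card J = s" "finite J"
        using obtain_subset_with_card_n[of s I] by auto
      then have "J \<in> ?NS" using I by (auto simp: nsets_def independent_def)
      then have "f \<notin> B J" using f by auto
      then obtain e where e: "e \<in> [J]\<^bsup>Suc l\<^esup>" "f e \<notin> {1..<Q}" using f by (auto simp: B_def)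
      have "e \<in> ?A" using e J I by (auto simp: nsets_def independent_def)
      then have "f e < Q" using f(1) by auto
      then have "e \<in> E" using e \<open>e \<in> ?A\<close> by (auto simp: E_def)
      then show False using I e J unfolding independent_def nsets_def by blast
    qed
  next
    fix S assume S: "S \<in> ?NL"
    show "deg E S \<le> k"
    proof (rule ccontr)
      assume "\<not> deg E S \<le> k"
      then have "k \<le> card {y. insert y S \<in> E}"
        using deg_eq_card_extensions[OF H, of S] S by (simp add: nsets_def)
      then obtain K where K: "K \<subseteq> {y. insert y S \<in> E}" "card K = k" "finite K"
        using obtain_subset_with_card_n by metis
      have KA: "insert y S \<in> ?A" "f (insert y S) = 0" if "y \<in> K" for y using K that by (auto simp: E_def)
      have yS: "y \<notin> S" if "y \<in> K" for y
        using KA(1)[OF that] S by (auto simp: nsets_def insert_absorb)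
      have "inj_on (\<lambda>y. insert y S) K" using yS by (auto intro!: inj_onI)
      moreover have "K \<in> ?NK" using KA K by (auto simp: nsets_def)
      ultimately have "f \<in> C S K" "K \<in> ?NK" using KA f by (auto simp: C_def)
      then show False using f S by auto
    qed
  qed
qed

section \<open>Blow-ups along residue classes\<close>

lemma card_residue_class_le: "card {y \<in> {..<n}. y mod m = a} \<le> n div m + 1" for m n a :: nat
proof -
  have "inj_on (\<lambda>y. y div m) {y \<in> {..<n}. y mod m = a}"
  proof (rule inj_onI)
    fix x y assume "x \<in> {y \<in> {..<n}. y mod m = a}" "y \<in> {y \<in> {..<n}. y mod m = a}" "x div m = y div m"
    then show "x = y" using div_mult_mod_eq[of x m] div_mult_mod_eq[of y m] by simp
  qed
  moreover have "(\<lambda>y. y div m) ` {y \<in> {..<n}. y mod m = a} \<subseteq> {..n div m}"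
    by (auto intro: div_le_mono)
  ultimately have "card {y \<in> {..<n}. y mod m = a} \<le> card {..n div m}"
    by (intro card_inj_on_le) auto
  then show ?thesis by simp
qed

text \<open>The groups are the residue classes modulo \<open>m\<close>. An independent set meets at
  most \<open>s - 1\<close> groups, as its projection is independent, and has at most
  \<open>l\<close> vertices in each, as all \<open>Suc l\<close>-sets inside a group are
  edges.\<close>

lemma T_min_blow_up:
  assumes H: "r_graph (Suc l) {..<m} E" and m: "0 < m" and l: "2 \<le> l"
    and ind: "\<And>I. independent {..<m} E I \<Longrightarrow> card I < s"
    and deg: "\<And>S. S \<in> [{..<m}]\<^bsup>l\<^esup> \<Longrightarrow> deg E S \<le> k"
    and k: "1 \<le> k" and st: "(s - 1) * l < t" and n: "l \<le> n"
  shows "T_min l n t (Suc l) \<le> k * (n div m + 1)"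
proof -
  let ?\<pi> = "\<lambda>v::nat. v mod m"
  define F where "F = {e \<in> [{..<n}]\<^bsup>Suc l\<^esup>. (\<exists>a. \<forall>v\<in>e. ?\<pi> v = a) \<or> ?\<pi> ` e \<in> E}"
  have HF: "r_graph (Suc l) {..<n} F" by (auto simp: r_graph_def F_def)
  have cE: "card e = Suc l" if "e \<in> E" for e using that H by (auto simp: r_graph_def nsets_def)
  show ?thesis
  proof (rule T_min_le[OF HF])
    fix I assume I: "independent {..<n} F I"
    have fI: "finite I" using I by (auto simp: independent_def intro: finite_subset)
    have "independent {..<m} E (?\<pi> ` I)"
      unfolding independent_def
    proof (intro conjI notI)
      show "?\<pi> ` I \<subseteq> {..<m}" using m by auto
      assume "\<exists>e\<in>E. e \<subseteq> ?\<pi> ` I"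
      then obtain e where e: "e \<in> E" "e \<subseteq> ?\<pi> ` I" by auto
      then obtain U where U: "U \<subseteq> I" "inj_on ?\<pi> U" "e = ?\<pi> ` U" by (meson subset_image_inj)
      then have "card U = Suc l" using cE[OF e(1)] by (simp add: card_image)
      then have "U \<in> F" using U e I fI by (auto simp: F_def nsets_def independent_def intro: finite_subset)
      then show False using I U by (auto simp: independent_def)
    qed
    then have c1: "card (?\<pi> ` I) \<le> s - 1" using ind by fastforce
    have c2: "card {v \<in> I. ?\<pi> v = a} \<le> l" for a
    proof (rule ccontr)
      assume "\<not> ?thesis"
      then obtain U where U: "U \<subseteq> {v \<in> I. ?\<pi> v = a}" "card U = Suc l" "finite U"
        using obtain_subset_with_card_n[of "Suc l" "{v \<in> I. ?\<pi> v = a}"] by auto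
      then have "\<forall>v\<in>U. ?\<pi> v = a" by auto
      then have "U \<in> F" using U I unfolding F_def nsets_def independent_def by blast
      then show False using I U by (auto simp: independent_def)
    qed
    have "I = (\<Union>a\<in>?\<pi> ` I. {v \<in> I. ?\<pi> v = a})" by auto
    then have "card I \<le> (\<Sum>a\<in>?\<pi> ` I. card {v \<in> I. ?\<pi> v = a})"
      using card_UN_le[of "?\<pi> ` I" "\<lambda>a. {v \<in> I. ?\<pi> v = a}"] fI by simp
    also have "\<dots> \<le> (\<Sum>a\<in>?\<pi> ` I. l)" by (intro sum_mono c2)
    also have "\<dots> \<le> (s - 1) * l" using c1 by simp
    finally show "card I < t" using st by simp
  next
    fix S assume S: "S \<in> [{..<n}]\<^bsup>l\<^esup>"
    have fS: "finite S" "card S = l" using S by (auto simp: nsets_def)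
    have "card {y. insert y S \<in> F} \<le> k * (n div m + 1)"
    proof (cases "\<exists>a. \<forall>v\<in>S. ?\<pi> v = a")
      case True
      then obtain a where a: "\<And>v. v \<in> S \<Longrightarrow> ?\<pi> v = a" by auto
      have "{y. insert y S \<in> F} \<subseteq> {y \<in> {..<n}. ?\<pi> y = a}"
      proof
        fix y assume y: "y \<in> {y. insert y S \<in> F}"
        obtain v where v: "v \<in> S" using fS l by fastforce
        \<comment> \<open>\<open>y\<close> and \<open>S\<close> occupy at most two groups, but an
          edge of \<open>E\<close> has at least three vertices. So \<open>S\<close> is extended only
          within its own group.\<close>
        have "?\<pi> ` insert y S \<notin> E"
        proof
          assume "?\<pi> ` insert y S \<in> E"
          then have "card (?\<pi> ` insert y S) = Suc l" by (rule cE)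
          moreover have "?\<pi> ` insert y S \<subseteq> {?\<pi> y, a}" using a by auto
          then have "card (?\<pi> ` insert y S) \<le> card {?\<pi> y, a}" by (intro card_mono) auto
          moreover have "card {?\<pi> y, a} \<le> 2" by (simp add: card_insert_if)
          ultimately show False using l by simp
        qed
        then have "?\<pi> y = ?\<pi> v" using y v by (auto simp: F_def)
        then show "y \<in> {y \<in> {..<n}. ?\<pi> y = a}" using a[OF v] y by (auto simp: F_def nsets_def)
      qed
      then have "card {y. insert y S \<in> F} \<le> card {y \<in> {..<n}. ?\<pi> y = a}" by (intro card_mono) auto
      also have "\<dots> \<le> 1 * (n div m + 1)" using card_residue_class_le by simp
      also have "\<dots> \<le> k * (n div m + 1)" using k by (intro mult_right_mono) auto
      finally show ?thesis .
    next
      case False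
      let ?Z = "{z. insert z (?\<pi> ` S) \<in> E}"
      have "?Z \<subseteq> {..<m}" using H by (auto simp: r_graph_def nsets_def)
      then have fZ: "finite ?Z" by (meson finite_lessThan finite_subset)
      \<comment> \<open>Here \<open>S\<close> meets two groups, so the group of \<open>y\<close>
        must complete the projection of \<open>S\<close> to an edge of \<open>E\<close>; at most
        \<open>k\<close> groups do.\<close>
      have "{y. insert y S \<in> F} \<subseteq> (\<Union>z\<in>?Z. {y \<in> {..<n}. ?\<pi> y = z})"
        using False by (auto simp: F_def nsets_def)
      then have "card {y. insert y S \<in> F} \<le> card (\<Union>z\<in>?Z. {y \<in> {..<n}. ?\<pi> y = z})"
        using fZ by (intro card_mono) auto
      also have "\<dots> \<le> (\<Sum>z\<in>?Z. card {y \<in> {..<n}. ?\<pi> y = z})" by (intro card_UN_le fZ)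
      also have "\<dots> \<le> (\<Sum>z\<in>?Z. n div m + 1)" by (intro sum_mono card_residue_class_le)
      also have "\<dots> = card ?Z * (n div m + 1)" by simp
      also have "\<dots> \<le> k * (n div m + 1)"
        using fS card_image_le[of S ?\<pi>]
        by (intro mult_right_mono card_extensions_le[OF H deg]) auto
      finally show ?thesis .
    qed
    then show "deg F S \<le> k * (n div m + 1)" using deg_eq_card_extensions[OF HF, of S] fS by simp
  qed (use n in auto)
qed

lemma tau_blow_up_le:
  fixes m k :: nat
  assumes H: "r_graph (Suc l) {..<m} E" and m: "0 < m" and l: "2 \<le> l"
    and ind: "\<And>I. independent {..<m} E I \<Longrightarrow> card I < s"
    and deg: "\<And>S. S \<in> [{..<m}]\<^bsup>l\<^esup> \<Longrightarrow> deg E S \<le> k"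
    and k: "1 \<le> k" and st: "(s - 1) * l < t" and t: "Suc l \<le> t"
  shows "tau l t (Suc l) \<le> k / m"
proof (rule tendsto_le[OF _ _ T_min_ratio_tendsto_tau[OF t]])
  show "(\<lambda>n. k / m + k / real n) \<longlonglongrightarrow> k / m" by real_asymp
  show "\<forall>\<^sub>F n in sequentially. real (T_min l n t (Suc l)) / n \<le> k / m + k / real n"
    using eventually_ge_at_top[of "max 1 l"]
  proof eventually_elim
    case (elim n)
    have "real (T_min l n t (Suc l)) \<le> real (k * (n div m + 1))"
      using elim by (intro of_nat_mono T_min_blow_up[OF H m l ind deg k st]) auto
    also have "\<dots> = k * (real (n div m) + 1)" by (simp add: distrib_left)
    also have "\<dots> \<le> k * (n / m + 1)" by (intro mult_left_mono add_right_mono of_nat_div_le_of_nat) simp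
    finally show ?case using elim m by (simp add: field_simps)
  qed
qed simp

text \<open>\<open>k ^ k / fact k\<close> is a single term of the series of exp(k). This takes the
  place of Stirling's formula.\<close>

lemma power_le_exp_fact: "real k ^ k \<le> exp (real k) * fact k"
proof -
  have "summable (\<lambda>n. real k ^ n /\<^sub>R fact n)" by (rule summable_exp_generic)
  then have "sum (\<lambda>n. real k ^ n /\<^sub>R fact n) {k} \<le> exp (real k)"
    unfolding exp_def by (intro sum_le_suminf) auto
  then show ?thesis by (simp add: field_simps)
qed

lemma binomial_le_exp_power:
  fixes m k :: nat
  assumes "0 < k"
  shows "real (m choose k) \<le> (exp 1 * m / k) ^ k"
proof (cases "k \<le> m")
  case True
  have "real (m choose k) * fact k \<le> real m ^ k"
    using binomial_fact_pow[of m k] True by (metis of_nat_fact of_nat_le_iff of_nat_mult of_nat_power)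
  then have "real (m choose k) * fact k * (exp k * fact k) \<le> real m ^ k * (exp k * fact k)"
    by (intro mult_right_mono) auto
  then have "real (m choose k) * (exp k * fact k) \<le> real m ^ k * exp k" by simp
  moreover have "real (m choose k) * real k ^ k \<le> real (m choose k) * (exp k * fact k)"
    by (intro mult_left_mono power_le_exp_fact) auto
  ultimately have "real (m choose k) * real k ^ k \<le> real m ^ k * exp k" by linarith
  then show ?thesis
    using assms by (simp add: power_divide power_mult_distrib exp_of_nat_mult[symmetric] field_simps)
next
  case False
  then show ?thesis by (simp add: binomial_eq_0)
qed

section \<open>The upper bound\<close>

lemma binomial_le_power: "m choose s \<le> m ^ s" for m s :: nat
  by (cases "s \<le> m") (simp_all add: binomial_le_pow binomial_eq_0)

text \<open>With edge probability \<open>1 / Q\<close> of order \<open>C * ln t / t ^ l\<close> on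
  \<open>t ^ Suc l\<close> vertices, codegrees have mean of order \<open>C * t * ln t\<close>. The
  cap \<open>k\<close> is \<open>12 * C * t * ln t\<close> rounded up, which 13 absorbs.\<close>

lemma tau_upper_eventually:
  assumes l: "2 \<le> l"
  defines "C \<equiv> real (Suc l ^ Suc l * l ^ l * (l + 2))"
  shows "\<forall>\<^sub>F t in sequentially. tau l t (Suc l) \<le> 13 * C * (ln (real t) / real t ^ l)"
proof -
  let ?r = "Suc l"
  have "?r * 1 * (l + 2) \<le> ?r ^ ?r * l ^ l * (l + 2)"
    using l self_le_power[of ?r ?r] by (intro mult_le_mono) (auto simp: Suc_le_eq)
  then have "real (?r * l + 1) \<le> C" unfolding C_def by (intro of_nat_mono) (simp add: algebra_simps)
  moreover have "1 \<le> real (?r * l + 1)" by simp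
  ultimately have C: "real (?r * l + 1) \<le> C" "1 \<le> C" by linarith+
  have "\<forall>\<^sub>F t::real in at_top. C * ln t \<le> t" using C by real_asymp
  then have "\<forall>\<^sub>F t in sequentially. C * ln (real t) \<le> real t"
    using filterlim_real_sequentially unfolding filterlim_iff by blast
  \<comment> \<open>\<open>l * l + 1 \<le> t\<close> ensures \<open>Suc l \<le> s\<close>, needed
    for the lower bound on \<open>?N\<close>; \<open>3 \<le> t\<close> ensures
    \<open>1 \<le> ln t\<close>.\<close>
  moreover have "\<forall>\<^sub>F t in sequentially. max (l * l + 1) 3 \<le> t" by (rule eventually_ge_at_top)
  ultimately show ?thesis
  proof eventually_elim
    case (elim t)
    have t3: "3 \<le> t" and t1: "1 < real t" and tl: "Suc l \<le> t"
      using elim l by auto (use mult_le_mono1[of 1 l l] elim in linarith)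
    define L where "L = ln (real t)"
    have L1: "1 \<le> L"
    proof -
      have "exp 1 \<le> real t" using exp_le t3 by linarith
      then show ?thesis using t1 unfolding L_def by (simp add: ln_ge_iff)
    qed
    define X where "X = real t ^ l / (C * L)"
    have X1: "1 \<le> X"
    proof -
      have "C * L \<le> real t" using elim by (simp add: L_def)
      also have "\<dots> \<le> real t ^ l" using t1 l power_increasing[of 1 l "real t"] by simp
      finally show ?thesis using C L1 by (simp add: X_def)
    qed
    define Q where "Q = nat \<lfloor>X\<rfloor>"
    have "1 \<le> \<lfloor>X\<rfloor>" "real Q = \<lfloor>X\<rfloor>" using X1 by (simp_all add: Q_def)
    then have Q: "0 < Q" "real Q \<le> X" "X / 2 \<le> real Q" by linarith+
    define m where "m = t ^ ?r"
    \<comment> \<open>This is \<open>t / l\<close> rounded up: \<open>(s - 1) * l < t\<close> serves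
      the blow-up, \<open>t \<le> s * l\<close> the estimate of \<open>?N\<close>.\<close>
    define s where "s = (t - 1) div l + 1"
    define k where "k = nat \<lceil>12 * C * t * L\<rceil>"
    have m0: "0 < m" using t3 by (simp add: m_def)
    have m_exp: "real m ^ a = exp (?r * a * L)" for a
    proof -
      have "real t = exp L" using t1 by (simp add: L_def)
      then have "real m = exp (?r * L)" by (simp add: m_def exp_of_nat_mult[symmetric] del: power_Suc)
      then show ?thesis by (simp add: exp_of_nat_mult[symmetric] algebra_simps)
    qed
    have CtL: "1 \<le> C * t * L" using C t1 L1 mult_mono[of 1 C 1 "t * L"] mult_mono[of 1 "real t" 1 L]
      by (simp add: mult.assoc)
    have k: "12 * C * t * L \<le> k" "k \<le> 13 * C * t * L" "1 \<le> k"
      using CtL unfolding k_def by linarith+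
    have st: "(s - 1) * l < t" using t3 div_times_less_eq_dividend[of "t - 1" l]
      unfolding s_def add_diff_cancel_right' by linarith
    have ts: "t \<le> s * l"
      using dividend_less_div_times[of l "t - 1"] l by (simp add: s_def)
    have rs: "?r \<le> s" using elim l div_le_mono[of "l * l" "t - 1" l] by (simp add: s_def)
    let ?N = "s choose ?r"
    \<comment> \<open>The shape of \<open>C\<close> comes from here: two of its factors absorb the
      losses in (s / r)^r \<le> \<open>?N\<close> and \<open>t \<le> s * l\<close>. The factor
      \<open>l + 2\<close> exceeds the exponent \<open>Suc l\<close> in \<open>m\<close> by one,
      which leaves exp(-s L) in the union bound.\<close>
    have N: "s * (l + 2) * L \<le> ?N / Q"
    proof -
      have "real t ^ l \<le> (real s * l) ^ l"
        using ts by (intro power_mono) (simp_all flip: of_nat_mult)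
      then have "s * real t ^ l \<le> s * (real s * l) ^ l" by (intro mult_left_mono) auto
      also have "\<dots> = (real s / ?r) ^ ?r * (real ?r ^ ?r * real l ^ l)"
        by (simp add: power_mult_distrib power_divide)
      also have "\<dots> \<le> ?N * (real ?r ^ ?r * real l ^ l)"
        using binomial_ge_n_over_k_pow_k[OF rs, where ?'a = real] by (intro mult_right_mono) auto
      finally have "s * real t ^ l * (l + 2) * L \<le> ?N * (real ?r ^ ?r * real l ^ l) * (l + 2) * L"
        using L1 by (intro mult_right_mono) auto
      also have "\<dots> = ?N * (C * L)"
        by (simp only: C_def of_nat_mult of_nat_power of_nat_add of_nat_numeral mult_ac)
      finally have "s * (l + 2) * L \<le> ?N / X"
        using t1 C L1 by (simp add: X_def field_simps)
      also have "\<dots> \<le> ?N / Q" using Q by (intro divide_left_mono) auto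
      finally show ?thesis .
    qed
    have T1: "(m choose s) * (1 - 1 / Q) ^ ?N \<le> 1 / t"
    proof -
      have "1 - 1 / real Q \<le> exp (- (1 / Q))" using exp_ge_add_one_self[of "- (1 / real Q)"] by simp
      then have "(1 - 1 / real Q) ^ ?N \<le> exp (- (1 / Q)) ^ ?N" using Q by (intro power_mono) auto
      also have "\<dots> = exp (- (?N / Q))" by (simp add: exp_of_nat_mult[symmetric])
      also have "\<dots> \<le> exp (- (s * (l + 2) * L))" using N by simp
      finally have "(m choose s) * (1 - 1 / real Q) ^ ?N \<le> real m ^ s * exp (- (s * (l + 2) * L))"
        using Q binomial_le_power[of m s] by (intro mult_mono) (auto simp flip: of_nat_power)
      also have "\<dots> = exp (- (s * L))"
        by (simp add: m_exp exp_add[symmetric]) (simp add: algebra_simps)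
      also have "\<dots> \<le> exp (- L)" using L1 rs mult_right_mono[of 1 "real s" L] by simp
      also have "\<dots> = 1 / t" using t1 by (simp add: L_def exp_minus inverse_eq_divide)
      finally show ?thesis .
    qed
    have T2: "(m choose l) * ((m choose k) * (1 / Q) ^ k) \<le> 1 / t"
    proof -
      \<comment> \<open>The 12 in \<open>k\<close> is halved by rounding \<open>X\<close> down to
        \<open>Q\<close>. With \<open>exp 1 \<le> 3\<close>, the remaining 6 makes the base of the
        \<open>k\<close>-th power below at most 1/2.\<close>
      have "6 * real m = (12 * C * t * L) * (X / 2)"
        using C L1 by (simp add: X_def m_def)
      also have "\<dots> \<le> real k * real Q" using k Q X1 by (intro mult_mono) auto
      finally have kQ: "6 * real m \<le> real k * real Q" .
      have "exp 1 * m / k * (1 / Q) = exp 1 * m / (real k * real Q)" by simp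
      also have "\<dots> \<le> 3 * m / (6 * m)"
        using kQ exp_le m0 by (intro frac_le mult_right_mono) auto
      also have "\<dots> = 1 / 2" using m0 by simp
      finally have half: "exp 1 * m / k * (1 / Q) \<le> 1 / 2" .
      have "(m choose k) * (1 / real Q) ^ k \<le> (exp 1 * m / k) ^ k * (1 / Q) ^ k"
        using k by (intro mult_right_mono binomial_le_exp_power) auto
      also have "\<dots> = (exp 1 * m / k * (1 / Q)) ^ k" by (rule power_mult_distrib[symmetric])
      also have "\<dots> \<le> (1 / 2) ^ k" using half by (intro power_mono) auto
      also have "\<dots> = exp (- (k * ln 2))" by (simp add: exp_minus exp_of_nat_mult power_one_over inverse_eq_divide)
      also have "\<dots> \<le> exp (- (6 * C * t * L))"
      proof -
        have "12 * C * t * L * (1 / 2) \<le> k * ln 2"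
          using k ln_one_plus_ge_half[of 1] CtL by (intro mult_mono) auto
        then show ?thesis by (simp add: mult_ac)
      qed
      finally have "(m choose l) * ((m choose k) * (1 / real Q) ^ k) \<le> real m ^ l * exp (- (6 * C * t * L))"
        using binomial_le_power[of m l] by (intro mult_mono) (auto simp flip: of_nat_power)
      also have "\<dots> = exp (?r * l * L - 6 * C * t * L)" by (simp add: m_exp exp_diff exp_minus divide_inverse)
      also have "\<dots> \<le> exp (- L)"
      proof -
        have "(?r * l + 1) * L \<le> 6 * C * t * L"
        proof (intro mult_right_mono)
          have "C * 1 \<le> C * (6 * t)" using C t1 by (intro mult_left_mono) auto
          also have "\<dots> = 6 * C * t" by simp
          finally show "real (?r * l + 1) \<le> 6 * C * t" using C(1) by linarith
        qed (use L1 in simp)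
        then show ?thesis by (simp add: algebra_simps)
      qed
      also have "\<dots> = 1 / t" using t1 by (simp add: L_def exp_minus inverse_eq_divide)
      finally show ?thesis .
    qed
    have "1 / real t \<le> 1 / 3" using t3 by (simp add: field_simps)
    then have "(m choose s) * (1 - 1 / real Q) ^ ?N + (m choose l) * ((m choose k) * (1 / real Q) ^ k) < 1"
      using T1 T2 by linarith
    then obtain E where E: "r_graph (Suc l) {..<m} E" "\<And>I. independent {..<m} E I \<Longrightarrow> card I < s"
      "\<And>S. S \<in> [{..<m}]\<^bsup>l\<^esup> \<Longrightarrow> deg E S \<le> k"
      using random_r_graph[OF Q(1)] by blast
    have "tau l t (Suc l) \<le> k / m" by (rule tau_blow_up_le[OF E(1) m0 l E(2,3) k(3) st tl])
    also have "\<dots> \<le> 13 * C * t * L / m" using k by (intro divide_right_mono) auto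
    also have "\<dots> = 13 * C * (L / real t ^ l)" using t1 by (simp add: m_def)
    finally show ?case by (simp add: L_def)
  qed
qed

lemma tau_upper:
  assumes l: "2 \<le> l"
  shows "\<exists>c>0. \<forall>t>Suc l. tau l t (Suc l) \<le> c * (ln (real t) / real t ^ l)"
proof -
  define c where "c = 13 * real (Suc l ^ Suc l * l ^ l * (l + 2))"
  obtain t0 where t0: "\<And>t. t \<ge> t0 \<Longrightarrow> tau l t (Suc l) \<le> c * (ln (real t) / real t ^ l)"
    using tau_upper_eventually[OF l] unfolding c_def eventually_sequentially by blast
  show ?thesis
  \<comment> \<open>For \<open>t < t0\<close> the bound \<open>tau \<le> 1\<close> suffices, because
    \<open>1 \<le> ln t\<close> and \<open>t ^ l \<le> t0 ^ l\<close>. The summand 1 keeps the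
    constant positive.\<close>
  proof (intro exI[of _ "max c (real t0 ^ l + 1)"] conjI allI impI)
    fix t assume t: "Suc l < t"
    then have t1: "exp 1 \<le> real t" using exp_le l by linarith
    then have ln1: "1 \<le> ln (real t)" using t by (simp add: ln_ge_iff)
    have pos: "0 \<le> ln (real t) / real t ^ l" using ln1 by simp
    show "tau l t (Suc l) \<le> max c (real t0 ^ l + 1) * (ln (real t) / real t ^ l)"
    proof (cases "t0 \<le> t")
      case True
      then show ?thesis using t0[OF True] pos mult_right_mono[of c "max c (real t0 ^ l + 1)"] by fastforce
    next
      case False
      have "tau l t (Suc l) \<le> 1" using t by (intro tau_le_one) simp
      also have "\<dots> \<le> real t0 ^ l * (1 / real t ^ l)"
        using False t by (simp add: power_mono)
      also have "\<dots> \<le> max c (real t0 ^ l + 1) * (ln (real t) / real t ^ l)"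
        using ln1 by (intro mult_mono divide_right_mono) (auto simp: le_max_iff_disj)
      finally show ?thesis .
    qed
  qed (simp add: less_max_iff_disj add_nonneg_pos)
qed

theorem theorem1p1:
  fixes r :: nat
  assumes "r \<ge> 3"
  shows "\<exists>c1 c2 :: real. c1 > 0 \<and> c2 > 0 \<and>
    (\<forall>t :: nat. t > r \<longrightarrow>
      c1 * (ln (real t) / real t ^ (r - 1)) \<le> tau (r - 1) t r \<and>
      tau (r - 1) t r \<le> c2 * (ln (real t) / real t ^ (r - 1)))"
proof -
  have r: "2 \<le> r - 1" "Suc (r - 1) = r" using assms by auto
  show ?thesis using tau_lower[OF r(1)] tau_upper[OF r(1)] unfolding r(2) by blast
qed

end
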